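(* (a) Let $V$ be a complete discrete valuation ring of mixed characteristic $p$ with maximal ideal $pV$. Let $R_i=V[[X_1,\dots,X_i]]$ for $1\le i\le n-1$, $R_0=V$, and $R=R_{n-1}$. Let $B$, $B_i$ denote the absolute integral closures of $R$, $R_i$ respectively, $0\le i\le n-1$. Then for $0\le i<n-1$, $\Omega_{B_i/V}$ is a direct summand of $\Omega_{B/V}$ as a $B_i$-module, and $\Omega_{B_i/R_i}$ is a direct summand of $\Omega_{B/R}$ as a $B_i$-module. (b) The analogous result is valid in equicharacteristic zero: let $k$ be a field of characteristic $0$, $R_i=k[[X_1,\dots,X_i]]$ for $1\le i\le n$, $R_0=k$, $R=R_n$, and let $B$, $B_i$ denote the absolute integral closures of $R$, $R_i$. Then for $0\le i<n$, $\Omega_{B_i/k}$ and $\Omega_{B_i/R_i}$ are direct summands, as $B_i$-modules, of $\Omega_{B/k}$ and $\Omega_{B/R}$ respectively.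
   Context: The absolute integral closure of a domain is its integral closure in an algebraic closure of its fraction field; $B_i$ is regarded as a subring of $B$ (the integral closure of $R_i$ in $B$). $\Omega$ denotes modules of Kähler differentials (not completed). *)

theory Defs
  imports "HOL-Algebra.Algebraic_Closure" "HOL-Algebra.Generated_Fields" "HOL-Algebra.Ideal_Product"
    "HOL-Algebra.Module" "HOL-Computational_Algebra.Primes"
begin

section \<open>Complete discrete valuation rings\<close>

definition has_characteristic :: "('a, 'm) ring_scheme \<Rightarrow> nat \<Rightarrow> bool"
  where "has_characteristic R c \<longleftrightarrow> (\<forall>n::nat. [n] \<cdot>\<^bsub>R\<^esub> \<one>\<^bsub>R\<^esub> = \<zero>\<^bsub>R\<^esub> \<longleftrightarrow> c dvd n)"

locale discrete_valuation_ring = principal_domain R for R (structure) +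
  assumes unique_nonzero_prime: "\<exists>!P. primeideal P R \<and> P \<noteq> {\<zero>}"

text \<open>Powers of ideals are taken in the library's semiring \<^const>\<open>ideals_set\<close> of ideals;
  in particular the zeroth power is the unit ideal.\<close>

definition adically_complete :: "('a, 'm) ring_scheme \<Rightarrow> 'a set \<Rightarrow> bool"
  where "adically_complete R I \<longleftrightarrow>
    (\<Inter>n::nat. I [^]\<^bsub>ideals_set R\<^esub> n) = {\<zero>\<^bsub>R\<^esub>} \<and>
    (\<forall>s :: nat \<Rightarrow> 'a. range s \<subseteq> carrier R \<and>
        (\<forall>n::nat. \<exists>N. \<forall>i\<ge>N. \<forall>j\<ge>N. s i \<ominus>\<^bsub>R\<^esub> s j \<in> I [^]\<^bsub>ideals_set R\<^esub> n) \<longrightarrow>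
        (\<exists>l\<in>carrier R. \<forall>n::nat. \<exists>N. \<forall>i\<ge>N. s i \<ominus>\<^bsub>R\<^esub> l \<in> I [^]\<^bsub>ideals_set R\<^esub> n))"


section \<open>Formal power series in several variables\<close>

text \<open>As in \<^theory>\<open>HOL-Algebra.Indexed_Polynomials\<close>, a monomial is the multiset of its variables
  and a series is its coefficient function.  With this encoding the ring on a set \<open>I\<close> of variables
  is literally a subring of the ring on any larger set, and constants are embedded by
  \<^const>\<open>ring.indexed_const\<close>.  For finite \<open>I\<close> this is the usual ring of formal power series.\<close>

definition power_series_ring :: "('a, 'm) ring_scheme \<Rightarrow> 'x set \<Rightarrow> ('x multiset \<Rightarrow> 'a) ring"
  where "power_series_ring R I =
    \<lparr> carrier = {f. (\<forall>m. f m \<in> carrier R) \<and> (\<forall>m. \<not> set_mset m \<subseteq> I \<longrightarrow> f m = \<zero>\<^bsub>R\<^esub>)},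
      monoid.mult = (\<lambda>f g m. \<Oplus>\<^bsub>R\<^esub>k\<in>{k. k \<subseteq># m}. f k \<otimes>\<^bsub>R\<^esub> g (m - k)),
      one = ring.indexed_const R \<one>\<^bsub>R\<^esub>,
      zero = ring.indexed_const R \<zero>\<^bsub>R\<^esub>,
      add = (\<lambda>f g m. f m \<oplus>\<^bsub>R\<^esub> g m) \<rparr>"


section \<open>Absolute integral closures\<close>

definition integral_over :: "('a, 'm) ring_scheme \<Rightarrow> 'a set \<Rightarrow> 'a \<Rightarrow> bool"
  where "integral_over S A x \<longleftrightarrow>
    (\<exists>P \<in> carrier (univ_poly S A). P \<noteq> [] \<and> lead_coeff P = \<one>\<^bsub>S\<^esub> \<and> ring.eval S P x = \<zero>\<^bsub>S\<^esub>)"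

definition integral_closure :: "('a, 'm) ring_scheme \<Rightarrow> 'a set \<Rightarrow> ('a, 'm) ring_scheme"
  where "integral_closure S A = S \<lparr> carrier := {x \<in> carrier S. integral_over S A x} \<rparr>"

text \<open>\<open>L\<close> is an algebraic closure of the fraction field of the domain \<open>R\<close>, embedded by \<open>\<phi>\<close>:
  inside \<open>L\<close> the fraction field is the subfield generated by the image of \<open>R\<close>.  The absolute
  integral closure of \<open>R\<close> is then \<^term>\<open>integral_closure L (\<phi> ` carrier R)\<close>.\<close>

definition algebraic_closure_of_fractions ::
    "('l, 'n) ring_scheme \<Rightarrow> ('a \<Rightarrow> 'l) \<Rightarrow> ('a, 'm) ring_scheme \<Rightarrow> bool"
  where "algebraic_closure_of_fractions L \<phi> R \<longleftrightarrow>
    \<phi> \<in> ring_hom R L \<and> inj_on \<phi> (carrier R) \<and>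
    algebraic_closure L (generate_field L (\<phi> ` carrier R))"


section \<open>Modules\<close>

text \<open>The multiplicative fields of a \<^type>\<open>module_scheme\<close> record play no role for modules.\<close>

definition free_module :: "('a, 'm) ring_scheme \<Rightarrow> 'x set \<Rightarrow> ('a, 'x \<Rightarrow> 'a) module"
  where "free_module R S =
    \<lparr> carrier = {f. (\<forall>x. f x \<in> carrier R) \<and> (\<forall>x. x \<notin> S \<longrightarrow> f x = \<zero>\<^bsub>R\<^esub>)
                    \<and> finite {x. f x \<noteq> \<zero>\<^bsub>R\<^esub>}},
      monoid.mult = (\<lambda>_ _. undefined),
      one = undefined,
      zero = (\<lambda>_. \<zero>\<^bsub>R\<^esub>),
      add = (\<lambda>f g x. f x \<oplus>\<^bsub>R\<^esub> g x),
      smult = (\<lambda>r f x. r \<otimes>\<^bsub>R\<^esub> f x) \<rparr>"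

definition basis_vector :: "('a, 'm) ring_scheme \<Rightarrow> 'x \<Rightarrow> 'x \<Rightarrow> 'a"
  where "basis_vector R x = (\<lambda>y. if y = x then \<one>\<^bsub>R\<^esub> else \<zero>\<^bsub>R\<^esub>)"

definition generated_submodule ::
    "('a, 'm) ring_scheme \<Rightarrow> ('a, 'b, 'n) module_scheme \<Rightarrow> 'b set \<Rightarrow> 'b set"
  where "generated_submodule R M G = \<Inter>{N. submodule N R M \<and> G \<subseteq> N}"

definition quotient_module :: "('a, 'b, 'n) module_scheme \<Rightarrow> 'b set \<Rightarrow> ('a, 'b set) module"
  where "quotient_module M N =
    \<lparr> carrier = a_rcosets\<^bsub>M\<^esub> N,
      monoid.mult = (\<lambda>_ _. undefined),
      one = undefined,
      zero = N,
      add = set_add M,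
      smult = (\<lambda>r C. \<Union>x\<in>C. N +>\<^bsub>M\<^esub> (r \<odot>\<^bsub>M\<^esub> x)) \<rparr>"

definition linear_map ::
    "('a, 'm) ring_scheme \<Rightarrow> ('a, 'b, 'n) module_scheme \<Rightarrow> ('a, 'c, 'o) module_scheme
      \<Rightarrow> ('b \<Rightarrow> 'c) \<Rightarrow> bool"
  where "linear_map R M N h \<longleftrightarrow>
    h \<in> carrier M \<rightarrow> carrier N \<and>
    (\<forall>x\<in>carrier M. \<forall>y\<in>carrier M. h (x \<oplus>\<^bsub>M\<^esub> y) = h x \<oplus>\<^bsub>N\<^esub> h y) \<and>
    (\<forall>r\<in>carrier R. \<forall>x\<in>carrier M. h (r \<odot>\<^bsub>M\<^esub> x) = r \<odot>\<^bsub>N\<^esub> h x)"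

definition direct_summand ::
    "'b set \<Rightarrow> ('a, 'm) ring_scheme \<Rightarrow> ('a, 'b, 'n) module_scheme \<Rightarrow> bool"
  where "direct_summand N R M \<longleftrightarrow> submodule N R M \<and>
    (\<exists>P. submodule P R M \<and> N \<inter> P = {\<zero>\<^bsub>M\<^esub>} \<and> N <+>\<^bsub>M\<^esub> P = carrier M)"


section \<open>Kaehler differentials\<close>

text \<open>For a subring \<open>A\<close> of a commutative ring \<open>B\<close>, the module \<open>\<Omega>\<^bsub>B/A\<^esub>\<close> is the free \<open>B\<close>-module on
  symbols \<open>d b\<close> modulo additivity, the Leibniz rule and \<open>d a = 0\<close> for \<open>a \<in> A\<close>.\<close>

definition kaehler_relations :: "('b, 'm) ring_scheme \<Rightarrow> 'b set \<Rightarrow> ('b \<Rightarrow> 'b) set"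
  where "kaehler_relations B A =
    (let F = free_module B (carrier B); e = basis_vector B in
      {e (b \<oplus>\<^bsub>B\<^esub> c) \<ominus>\<^bsub>F\<^esub> (e b \<oplus>\<^bsub>F\<^esub> e c) | b c. b \<in> carrier B \<and> c \<in> carrier B} \<union>
      {e (b \<otimes>\<^bsub>B\<^esub> c) \<ominus>\<^bsub>F\<^esub> (b \<odot>\<^bsub>F\<^esub> e c \<oplus>\<^bsub>F\<^esub> c \<odot>\<^bsub>F\<^esub> e b) | b c. b \<in> carrier B \<and> c \<in> carrier B} \<union>
      e ` A)"

definition kaehler_kernel :: "('b, 'm) ring_scheme \<Rightarrow> 'b set \<Rightarrow> ('b \<Rightarrow> 'b) set"
  where "kaehler_kernel B A =
    generated_submodule B (free_module B (carrier B)) (kaehler_relations B A)"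

definition kaehler :: "('b, 'm) ring_scheme \<Rightarrow> 'b set \<Rightarrow> ('b, ('b \<Rightarrow> 'b) set) module"
  where "kaehler B A = quotient_module (free_module B (carrier B)) (kaehler_kernel B A)"

definition kaehler_d :: "('b, 'm) ring_scheme \<Rightarrow> 'b set \<Rightarrow> 'b \<Rightarrow> ('b \<Rightarrow> 'b) set"
  where "kaehler_d B A b = kaehler_kernel B A +>\<^bsub>free_module B (carrier B)\<^esub> basis_vector B b"

text \<open>For subrings \<open>A' \<subseteq> A\<close> and \<open>B' \<subseteq> B\<close>, the canonical \<open>B'\<close>-linear map
  \<open>\<Omega>\<^bsub>B'/A'\<^esub> \<rightarrow> \<Omega>\<^bsub>B/A\<^esub>\<close> is determined by \<open>d b \<mapsto> d b\<close>.  The following says that it identifies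
  \<open>\<Omega>\<^bsub>B'/A'\<^esub>\<close> with a direct summand of the \<open>B'\<close>-module \<open>\<Omega>\<^bsub>B/A\<^esub>\<close>.  As the scalar
  multiplication of \<open>\<Omega>\<^bsub>B/A\<^esub>\<close> is defined on \<open>B\<close>, restriction of scalars to \<open>B'\<close> needs no change
  of record.\<close>

definition kaehler_direct_summand ::
    "('b, 'm) ring_scheme \<Rightarrow> 'b set \<Rightarrow> ('b, 'm) ring_scheme \<Rightarrow> 'b set \<Rightarrow> bool"
  where "kaehler_direct_summand B' A' B A \<longleftrightarrow>
    (\<exists>h. linear_map B' (kaehler B' A') (kaehler B A) h \<and>
         (\<forall>b\<in>carrier B'. h (kaehler_d B' A' b) = kaehler_d B A b) \<and>
         inj_on h (carrier (kaehler B' A')) \<and>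
         direct_summand (h ` carrier (kaehler B' A')) B' (kaehler B A))"

end

theory Submission
  imports Defs
begin

text \<open>Setting the variables \<open>X\<^sub>j\<close>, \<open>j > i\<close>, to zero is a retraction \<open>\<tau>\<close> of \<open>R\<close> onto \<open>R\<^sub>i\<close>.  It extends
  to a retraction of \<open>B\<close> onto \<open>B\<^sub>i\<close>: take a prime \<open>P\<close> of \<open>B\<close> over the kernel of \<open>\<tau>\<close>.  If \<open>b \<in> B\<close> is a root of
  the monic polynomial \<open>f\<close> over \<open>R\<close>, then \<open>b\<close> is modulo \<open>P\<close> a root of the image of \<open>f\<close> under \<open>\<tau>\<close>,
  which splits over \<open>B\<^sub>i\<close>; hence \<open>B\<^sub>i \<rightarrow> B/P\<close> is surjective, and it is injective because \<open>P\<close> meets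
  \<open>R\<^sub>i\<close> in zero.  A retraction of pairs of rings induces a retraction of the modules of differentials, and
  this splits the canonical map.\<close>

text \<open>The delicate point is that \<open>P\<close> must meet \<open>R\<close> exactly in the
  kernel of \<open>\<tau>\<close>. It is found by Zorn's lemma, as an ideal of \<open>B\<close>
  maximal among those disjoint from the elements of \<open>R\<close> that \<open>\<tau>\<close> does
  not kill. Disjointness bounds the intersection of \<open>P\<close> with \<open>R\<close> from
  above by the kernel. The reverse inclusion is harder: it combines maximality with an integral
  equation of an auxiliary element of \<open>B\<close>. The splitting takes place in the algebraic
  closure of the fraction field of \<open>R\<close>. A root found there of a monic polynomial over
  the smaller ring is integral over that ring, so it already lies in the smaller integral closure.
  The resulting map carries \<open>R\<close> into the smaller power series ring and fixes the
  constants. Hence one and the same map splits the differentials over the power series rings and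
  those over the coefficient ring.\<close>

section \<open>Integral equations as values of polynomials, and elimination\<close>

text \<open>Values stand in for polynomials: only the strict degree bound \<open>d\<close> is
  remembered, so all computations are ring arithmetic at the element \<open>x\<close>. The top
  coefficient may be zero.\<close>

fun (in ring) poly_values :: "'a set \<Rightarrow> 'a \<Rightarrow> nat \<Rightarrow> 'a set" where
  "poly_values A x 0 = {\<zero>}"
| "poly_values A x (Suc d) = {a \<otimes> x [^] d \<oplus> q | a q. a \<in> A \<and> q \<in> poly_values A x d}"

text \<open>The point of the definition is the case of the value zero:
  \<open>\<zero> \<in> monic_values A x d\<close> is a monic equation of degree \<open>d\<close> for
  \<open>x\<close> over \<open>A\<close>. Integrality is used in this form throughout.\<close>

definition (in ring) monic_values :: "'a set \<Rightarrow> 'a \<Rightarrow> nat \<Rightarrow> 'a set" where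
  "monic_values A x d = {x [^] d \<oplus> q | q. q \<in> poly_values A x d}"

definition (in ring) lincombs :: "'a set \<Rightarrow> 'i set \<Rightarrow> ('i \<Rightarrow> 'a) \<Rightarrow> 'a set" where
  "lincombs A I w = {(\<Oplus>i\<in>I. n i \<otimes> w i) | n. n \<in> I \<rightarrow> A}"

context cring
begin

text \<open>Bridge to coefficient lists, which carry the leading coefficient first. Leading zeros
  are allowed, so the length is a bound and not a degree.\<close>

lemma poly_values_eq_eval:
  "poly_values A x d = {eval p x | p. set p \<subseteq> A \<and> length p = d}"
proof (induction d)
  case (Suc d)
  have "{eval p x | p. set p \<subseteq> A \<and> length p = Suc d} =
    {eval (a # p) x | a p. a \<in> A \<and> set p \<subseteq> A \<and> length p = d}"
    by (rule Collect_cong, rule iffI; clarsimp simp: length_Suc_conv simp del: eval.simps)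
      (metis insert_subset list.simps(15))+
  also have "\<dots> = {a \<otimes> x [^] d \<oplus> q | a q. a \<in> A \<and> q \<in> {eval p x | p. set p \<subseteq> A \<and> length p = d}}"
    by fastforce
  finally show ?case using Suc.IH by simp
qed simp

context
  fixes A x
  assumes A: "subring A R" and x: "x \<in> carrier R"
begin

lemma base_in_carrier: "a \<in> A \<Longrightarrow> a \<in> carrier R"
  using subringE(1)[OF A] by blast

lemma poly_values_carrier: "q \<in> poly_values A x d \<Longrightarrow> q \<in> carrier R"
  using base_in_carrier x by (induction d arbitrary: q) auto

lemma poly_values_SucI:
  "a \<in> A \<Longrightarrow> q \<in> poly_values A x d \<Longrightarrow> a \<otimes> x [^] d \<oplus> q \<in> poly_values A x (Suc d)"
  by auto

lemma poly_values_zero: "\<zero> \<in> poly_values A x d"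
proof (induction d)
  case (Suc d)
  have "\<zero> = \<zero> \<otimes> x [^] d \<oplus> \<zero>" using x by simp
  then show ?case using poly_values_SucI[OF subringE(2)[OF A] Suc] by argo
qed simp

lemma poly_values_mono_Suc: "q \<in> poly_values A x d \<Longrightarrow> q \<in> poly_values A x (Suc d)"
proof -
  assume q: "q \<in> poly_values A x d"
  have "q = \<zero> \<otimes> x [^] d \<oplus> q" using x poly_values_carrier[OF q] by simp
  then show ?thesis using poly_values_SucI[OF subringE(2)[OF A] q] by argo
qed

lemma poly_values_mono: "q \<in> poly_values A x d \<Longrightarrow> d \<le> e \<Longrightarrow> q \<in> poly_values A x e"
  by (induction e) (auto simp: le_Suc_eq poly_values_mono_Suc simp del: poly_values.simps(2))

lemma poly_values_add:
  "q \<in> poly_values A x d \<Longrightarrow> r \<in> poly_values A x d \<Longrightarrow> q \<oplus> r \<in> poly_values A x d"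
proof (induction d arbitrary: q r)
  case (Suc d)
  then obtain a q' b r' where *: "q = a \<otimes> x [^] d \<oplus> q'" "a \<in> A" "q' \<in> poly_values A x d"
    "r = b \<otimes> x [^] d \<oplus> r'" "b \<in> A" "r' \<in> poly_values A x d" by auto
  have c: "a \<in> carrier R" "b \<in> carrier R" "q' \<in> carrier R" "r' \<in> carrier R" "x [^] d \<in> carrier R"
    using * base_in_carrier poly_values_carrier x by auto
  have "q \<oplus> r = (a \<oplus> b) \<otimes> x [^] d \<oplus> (q' \<oplus> r')"
    unfolding * using c by algebra
  moreover have "q' \<oplus> r' \<in> poly_values A x d" using Suc * by auto
  ultimately show ?case using poly_values_SucI[OF subringE(7)[OF A *(2,5)]] by presburger
qed simp

lemma poly_values_smult:
  "c \<in> A \<Longrightarrow> q \<in> poly_values A x d \<Longrightarrow> c \<otimes> q \<in> poly_values A x d"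
proof (induction d arbitrary: q)
  case (Suc d)
  then obtain a q' where *: "q = a \<otimes> x [^] d \<oplus> q'" "a \<in> A" "q' \<in> poly_values A x d" by auto
  have k: "a \<in> carrier R" "c \<in> carrier R" "q' \<in> carrier R" "x [^] d \<in> carrier R"
    using * base_in_carrier poly_values_carrier x Suc.prems by auto
  have "c \<otimes> q = (c \<otimes> a) \<otimes> x [^] d \<oplus> (c \<otimes> q')"
    unfolding * using k by algebra
  then show ?case 
    using poly_values_SucI[OF subringE(6)[OF A Suc.prems(1) *(2)] Suc.IH[OF Suc.prems(1) *(3)]] 
    by presburger
qed (use base_in_carrier in simp)

lemma poly_values_uminus: "q \<in> poly_values A x d \<Longrightarrow> \<ominus> q \<in> poly_values A x d"
proof -
  assume q: "q \<in> poly_values A x d"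
  have "\<ominus> q = (\<ominus> \<one>) \<otimes> q" using poly_values_carrier[OF q] by algebra
  then show ?thesis using poly_values_smult[OF _ q] subringE(3,5)[OF A] by auto
qed

lemma poly_values_shift: "q \<in> poly_values A x d \<Longrightarrow> x \<otimes> q \<in> poly_values A x (Suc d)"
proof (induction d arbitrary: q)
  case 0
  then show ?case using poly_values_zero[of 1] x by simp
next
  case (Suc d)
  then obtain a q' where *: "q = a \<otimes> x [^] d \<oplus> q'" "a \<in> A" "q' \<in> poly_values A x d" by auto
  have k: "a \<in> carrier R" "q' \<in> carrier R" "x [^] d \<in> carrier R" 
    using * base_in_carrier poly_values_carrier x by auto
  have "x \<otimes> q = a \<otimes> x [^] Suc d \<oplus> x \<otimes> q'"
    unfolding nat_pow_Suc * using k x by algebra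
  then show ?case using poly_values_SucI[OF *(2) Suc.IH[OF *(3)]] by presburger
qed

lemma poly_values_pow_mult: "q \<in> poly_values A x d \<Longrightarrow> x [^] k \<otimes> q \<in> poly_values A x (k + d)"
proof (induction k)
  case 0
  then show ?case using poly_values_carrier by simp
next
  case (Suc k)
  have "x [^] Suc k \<otimes> q = x \<otimes> (x [^] k \<otimes> q)"
    using x poly_values_carrier[OF Suc.prems] by (simp add: m_assoc m_lcomm m_comm)
  then show ?case using poly_values_shift[OF Suc.IH[OF Suc.prems]] by simp
qed

lemma poly_values_mult:
  "q \<in> poly_values A x d \<Longrightarrow> r \<in> poly_values A x e \<Longrightarrow> q \<otimes> r \<in> poly_values A x (d + e)"
proof (induction d arbitrary: q)
  case 0
  then show ?case using poly_values_zero poly_values_carrier by simp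
next
  case (Suc d)
  then obtain a q' where *: "q = a \<otimes> x [^] d \<oplus> q'" "a \<in> A" "q' \<in> poly_values A x d" by auto
  have k: "a \<in> carrier R" "q' \<in> carrier R" "r \<in> carrier R" "x [^] d \<in> carrier R" 
    using * base_in_carrier poly_values_carrier x Suc.prems by auto
  have "q \<otimes> r = a \<otimes> (x [^] d \<otimes> r) \<oplus> q' \<otimes> r"
    unfolding * using k x by algebra
  then have "q \<otimes> r \<in> poly_values A x (d + e)"
    using poly_values_add poly_values_smult[OF *(2) poly_values_pow_mult[OF Suc.prems(2)]]
      Suc.IH[OF *(3) Suc.prems(2)] by simp
  \<comment> \<open>The induction yields the sharper bound \<open>d + e\<close>; the bound claimed
    for \<open>Suc d\<close> is larger by one.\<close>
  then show ?case using poly_values_mono by (metis add_Suc le_add2 plus_1_eq_Suc)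
qed

lemma pow_in_poly_values: "k < d \<Longrightarrow> x [^] k \<in> poly_values A x d"
proof -
  assume "k < d"
  have "x [^] k = \<one> \<otimes> x [^] k \<oplus> \<zero>" using x by simp
  then have "x [^] k \<in> poly_values A x (Suc k)" 
    using poly_values_SucI[OF subringE(3)[OF A] poly_values_zero] by metis
  then show ?thesis by (rule poly_values_mono) (use \<open>k < d\<close> in simp)
qed

lemma monic_values_carrier: "q \<in> monic_values A x d \<Longrightarrow> q \<in> carrier R"
  unfolding monic_values_def using poly_values_carrier x by auto

lemma monic_poly_values_mult:
  assumes "m \<in> monic_values A x d" "q \<in> poly_values A x e"
  shows "m \<otimes> q \<in> poly_values A x (d + e)"
proof -
  obtain r where r: "m = x [^] d \<oplus> r" "r \<in> poly_values A x d"
    using assms(1) unfolding monic_values_def by auto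
  have "m \<otimes> q = x [^] d \<otimes> q \<oplus> r \<otimes> q"
    unfolding r using x poly_values_carrier r(2) assms(2) l_distr by simp
  then show ?thesis
    using poly_values_add poly_values_pow_mult[OF assms(2)] poly_values_mult[OF r(2) assms(2)] by simp
qed

lemma monic_values_mult:
  assumes "m \<in> monic_values A x d" "m' \<in> monic_values A x e"
  shows "m \<otimes> m' \<in> monic_values A x (d + e)"
proof -
  obtain r where r: "m' = x [^] e \<oplus> r" "r \<in> poly_values A x e"
    using assms(2) unfolding monic_values_def by auto
  obtain q where q: "m = x [^] d \<oplus> q" "q \<in> poly_values A x d"
    using assms(1) unfolding monic_values_def by auto
  have c: "x [^] d \<in> carrier R" "x [^] e \<in> carrier R" "q \<in> carrier R" "r \<in> carrier R"
    using x poly_values_carrier r(2) q(2) by auto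
  have "m \<otimes> m' = x [^] d \<otimes> x [^] e \<oplus> (x [^] e \<otimes> q \<oplus> m \<otimes> r)"
    unfolding q r using c by algebra
  moreover have "x [^] d \<otimes> x [^] e = x [^] (d + e)" using x nat_pow_mult by simp
  moreover have "x [^] e \<otimes> q \<oplus> m \<otimes> r \<in> poly_values A x (d + e)"
    using poly_values_add monic_poly_values_mult[OF assms(1) r(2)] 
      poly_values_pow_mult[OF q(2), of e] by (simp add: add.commute)
  ultimately show ?thesis unfolding monic_values_def by auto
qed

lemma monic_values_minus:
  assumes "m \<in> monic_values A x d" "q \<in> poly_values A x d"
  shows "m \<ominus> q \<in> monic_values A x d"
proof -
  obtain r where r: "m = x [^] d \<oplus> r" "r \<in> poly_values A x d"
    using assms(1) unfolding monic_values_def by auto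
  have "m \<ominus> q = x [^] d \<oplus> (r \<oplus> \<ominus> q)"
    unfolding r using x poly_values_carrier[OF r(2)] poly_values_carrier[OF assms(2)] 
    by (simp add: a_assoc minus_eq)
  then show ?thesis
    unfolding monic_values_def using poly_values_add[OF r(2) poly_values_uminus[OF assms(2)]] by auto
qed

text \<open>Gaussian elimination that multiplies the rows by the pivots: it keeps the diagonal monic and
  the other entries of smaller degree, which replaces the determinant trick.\<close>

lemma monic_values_elimination:
  assumes "finite S" "i0 \<notin> S" "v \<in> insert i0 S \<rightarrow> carrier R"
    and "\<And>i. i \<in> insert i0 S \<Longrightarrow> m i i \<in> monic_values A x d"
    and "\<And>i j. i \<in> insert i0 S \<Longrightarrow> j \<in> insert i0 S \<Longrightarrow> i \<noteq> j \<Longrightarrow> m i j \<in> poly_values A x d"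
    and "\<And>i. i \<in> insert i0 S \<Longrightarrow> (\<Oplus>j\<in>insert i0 S. m i j \<otimes> v j) = \<zero>"
  shows "\<exists>e. \<exists>u\<in>monic_values A x e. u \<otimes> v i0 = \<zero>"
  using assms
proof (induction S arbitrary: m d rule: finite_induct)
  case empty
  have "m i0 i0 \<otimes> v i0 \<in> carrier R" using empty monic_values_carrier by auto
  then have "m i0 i0 \<otimes> v i0 = \<zero>" using empty.prems(5)[of i0] by auto
  then show ?case using empty.prems(3)[of i0] by auto
next
  case (insert k S)
  let ?T = "insert i0 S"
  have T: "insert i0 (insert k S) = insert k ?T" "k \<notin> ?T" "finite ?T" using insert by auto
  note p = insert.prems[unfolded T(1)]
  have mc: "m i j \<in> carrier R" if "i \<in> insert k ?T" "j \<in> insert k ?T" for i j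
    using monic_values_carrier[OF p(3)[OF that(1)]] poly_values_carrier[OF p(4)[OF that]] by metis
  have vc: "v j \<in> carrier R" if "j \<in> insert k ?T" for j using p(2) that by auto
  \<comment> \<open>Row \<open>i\<close> is multiplied by the pivot \<open>m k k\<close>, and
    \<open>m i k\<close> times row \<open>k\<close> is subtracted. This clears column
    \<open>k\<close> without dividing by the pivot.\<close>
  define m' where "m' i j = m k k \<otimes> m i j \<ominus> m i k \<otimes> m k j" for i j
  have rest: "(\<Oplus>j\<in>?T. m i j \<otimes> v j) = \<ominus> (m i k \<otimes> v k)" if i: "i \<in> insert k ?T" for i
  proof -
    have c: "(\<Oplus>j\<in>?T. m i j \<otimes> v j) \<in> carrier R" "m i k \<otimes> v k \<in> carrier R"
      using mc vc i by (auto intro!: finsum_closed)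
    have "m i k \<otimes> v k \<oplus> (\<Oplus>j\<in>?T. m i j \<otimes> v j) = \<zero>"
      using p(5)[OF i] finsum_insert[OF T(3,2), of "\<lambda>j. m i j \<otimes> v j"] mc vc i by auto
    then show ?thesis using c by (metis a_comm minus_equality)
  qed
  have row: "(\<Oplus>j\<in>?T. m' i j \<otimes> v j) = \<zero>" if i: "i \<in> ?T" for i
  proof -
    have "(\<Oplus>j\<in>?T. m' i j \<otimes> v j) =
        (\<Oplus>j\<in>?T. m k k \<otimes> (m i j \<otimes> v j) \<oplus> (\<ominus> m i k) \<otimes> (m k j \<otimes> v j))"
    proof (rule finsum_cong')
      fix j assume j: "j \<in> ?T"
      have "m k k \<in> carrier R" "m i j \<in> carrier R" "m i k \<in> carrier R" "m k j \<in> carrier R" "v j \<in> carrier R"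
        using i j mc vc by auto
      then show "m' i j \<otimes> v j = m k k \<otimes> (m i j \<otimes> v j) \<oplus> (\<ominus> m i k) \<otimes> (m k j \<otimes> v j)"
        unfolding m'_def by algebra
    qed (use i mc vc in auto)
    also have "\<dots> = (\<Oplus>j\<in>?T. m k k \<otimes> (m i j \<otimes> v j)) \<oplus> (\<Oplus>j\<in>?T. (\<ominus> m i k) \<otimes> (m k j \<otimes> v j))"
      by (rule finsum_addf) (use i mc vc in auto)
    also have "\<dots> = m k k \<otimes> (\<Oplus>j\<in>?T. m i j \<otimes> v j) \<oplus> (\<ominus> m i k) \<otimes> (\<Oplus>j\<in>?T. m k j \<otimes> v j)"
      using i mc vc by (subst (1 2) finsum_rdistr) (use T(3) in auto)
    also have "\<dots> = m k k \<otimes> (\<ominus> (m i k \<otimes> v k)) \<oplus> (\<ominus> m i k) \<otimes> (\<ominus> (m k k \<otimes> v k))"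
      using rest i by simp
    also have "\<dots> = \<zero>"
    proof -
      have "m k k \<in> carrier R" "m i k \<in> carrier R" "v k \<in> carrier R" using i mc vc by auto
      then show ?thesis by algebra
    qed
    finally show ?thesis .
  qed
  show ?case
  \<comment> \<open>New entries are built from products of two old ones, so the degree bound
    doubles. On the diagonal \<open>m k k \<otimes> m i i\<close> is monic of degree
    \<open>d + d\<close>, and the subtracted product has smaller degree because both of its factors
    lie off the diagonal.\<close>
  proof (rule insert.IH[of m' "d + d"])
    show "i0 \<notin> S" "v \<in> ?T \<rightarrow> carrier R" using insert.prems by auto
    show "m' i i \<in> monic_values A x (d + d)" if i: "i \<in> ?T" for i
    proof -
      have "i \<noteq> k" using i T(2) by auto
      then show ?thesis unfolding m'_def
        using p(3,4) i monic_values_minus monic_values_mult poly_values_mult by simp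
    qed
    show "m' i j \<in> poly_values A x (d + d)" if ij: "i \<in> ?T" "j \<in> ?T" "i \<noteq> j" for i j
    proof -
      have "i \<noteq> k" "j \<noteq> k" using ij T(2) by auto
      then show ?thesis unfolding m'_def minus_eq
        using p(3,4) ij poly_values_add poly_values_uminus monic_poly_values_mult poly_values_mult by simp
    qed
    show "(\<Oplus>j\<in>?T. m' i j \<otimes> v j) = \<zero>" if "i \<in> ?T" for i using row that .
  qed
qed

text \<open>Cayley-Hamilton in the form used for integrality: a matrix \<open>x - n\<close> with
  \<open>n\<close> over \<open>A\<close> annihilates the vector \<open>w\<close>, and elimination
  extracts a monic value that kills \<open>w i0\<close>. As \<open>w i0\<close> is one, this value
  is itself zero.\<close>

lemma monic_value_zero_of_stable:
  assumes I: "finite I" "i0 \<in> I" and w: "w \<in> I \<rightarrow> carrier R" "w i0 = \<one>"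
    and stable: "\<And>i. i \<in> I \<Longrightarrow> x \<otimes> w i \<in> lincombs A I w"
  shows "\<exists>d. \<zero> \<in> monic_values A x d"
proof -
  have "\<forall>i\<in>I. \<exists>n. n \<in> I \<rightarrow> A \<and> x \<otimes> w i = (\<Oplus>j\<in>I. n j \<otimes> w j)"
    using stable unfolding lincombs_def by auto
  then obtain n where n: "\<And>i. i \<in> I \<Longrightarrow> n i \<in> I \<rightarrow> A"
    "\<And>i. i \<in> I \<Longrightarrow> x \<otimes> w i = (\<Oplus>j\<in>I. n i j \<otimes> w j)" by metis
  \<comment> \<open>The matrix \<open>x - n\<close>: monic of degree 1 on the diagonal and constants
    from \<open>A\<close> elsewhere, so the elimination starts with degree 1.\<close>
  define m where "m i j = (if j = i then x else \<zero>) \<ominus> n i j" for i j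
  have I': "I = insert i0 (I - {i0})" using I by auto
  have nc: "n i j \<in> A" "n i j \<in> carrier R" if "i \<in> I" "j \<in> I" for i j
    using n(1) that base_in_carrier by blast+
  have const: "a \<in> poly_values A x 1" if "a \<in> A" for a
  proof -
    have "a = a \<otimes> x [^] (0::nat) \<oplus> \<zero>" using base_in_carrier[OF that] by simp
    then show ?thesis using that by (auto simp: One_nat_def)
  qed
  have "\<exists>e. \<exists>u\<in>monic_values A x e. u \<otimes> w i0 = \<zero>"
  proof (rule monic_values_elimination[of "I - {i0}" i0 w m 1], unfold I'[symmetric])
    show "m i i \<in> monic_values A x 1" if i: "i \<in> I" for i
    proof -
      have "x \<in> monic_values A x 1"
        unfolding monic_values_def using poly_values_zero[of 1] x by force
      then show ?thesis unfolding m_def using monic_values_minus const nc i by simp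
    qed
    show "m i j \<in> poly_values A x 1" if "i \<in> I" "j \<in> I" "i \<noteq> j" for i j
      using that nc[of i j] const[of "n i j"] poly_values_uminus[of "n i j" 1] unfolding m_def minus_eq
      by auto
    show "(\<Oplus>j\<in>I. m i j \<otimes> w j) = \<zero>" if i: "i \<in> I" for i
    proof -
      have wc: "w j \<in> carrier R" if "j \<in> I" for j using w(1) that by auto
      have "(\<Oplus>j\<in>I. m i j \<otimes> w j) = 
          (\<Oplus>j\<in>I. (if i = j then x \<otimes> w j else \<zero>) \<oplus> (\<ominus> \<one>) \<otimes> (n i j \<otimes> w j))"
      proof (rule finsum_cong')
        fix j assume j: "j \<in> I"
        have "n i j \<in> carrier R" "w j \<in> carrier R" using nc i j wc by auto
        then show "m i j \<otimes> w j = (if i = j then x \<otimes> w j else \<zero>) \<oplus> (\<ominus> \<one>) \<otimes> (n i j \<otimes> w j)"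
          unfolding m_def using x i by (cases "i = j") (simp_all add: minus_eq l_distr l_minus)
      qed (use i nc wc x in auto)
      also have "\<dots> = (\<Oplus>j\<in>I. if i = j then x \<otimes> w j else \<zero>) \<oplus> (\<Oplus>j\<in>I. (\<ominus> \<one>) \<otimes> (n i j \<otimes> w j))"
        by (rule finsum_addf) (use i nc wc x in auto)
      also have "(\<Oplus>j\<in>I. if i = j then x \<otimes> w j else \<zero>) = x \<otimes> w i"
        using finsum_singleton[OF i I(1), of "\<lambda>j. x \<otimes> w j"] wc x by auto
      also have "(\<Oplus>j\<in>I. (\<ominus> \<one>) \<otimes> (n i j \<otimes> w j)) = (\<ominus> \<one>) \<otimes> (\<Oplus>j\<in>I. n i j \<otimes> w j)"
        by (rule finsum_rdistr[symmetric]) (use I i nc wc in auto)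
      also have "\<dots> = (\<ominus> \<one>) \<otimes> (x \<otimes> w i)" using n(2)[OF i] by simp
      also have "x \<otimes> w i \<oplus> (\<ominus> \<one>) \<otimes> (x \<otimes> w i) = \<zero>"
        using x wc[OF i] by algebra
      finally show ?thesis .
    qed
  qed (use I w in auto)
  then show ?thesis using w(2) monic_values_carrier by fastforce
qed

end

end

section \<open>Sums and products of integral elements, and the ring they form\<close>

context cring
begin

context
  fixes A assumes A: "subring A R"
begin

lemma lincombsI: "n \<in> I \<rightarrow> A \<Longrightarrow> y = (\<Oplus>i\<in>I. n i \<otimes> w i) \<Longrightarrow> y \<in> lincombs A I w"
  unfolding lincombs_def by auto

lemma lincombs_add:
  assumes w: "w \<in> I \<rightarrow> carrier R" and "y \<in> lincombs A I w" "z \<in> lincombs A I w"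
  shows "y \<oplus> z \<in> lincombs A I w"
proof -
  obtain n m where n: "n \<in> I \<rightarrow> A" "y = (\<Oplus>i\<in>I. n i \<otimes> w i)"
    and m: "m \<in> I \<rightarrow> A" "z = (\<Oplus>i\<in>I. m i \<otimes> w i)"
    using assms(2,3) unfolding lincombs_def by auto
  have c: "n \<in> I \<rightarrow> carrier R" "m \<in> I \<rightarrow> carrier R" 
    using n(1) m(1) subringE(1)[OF A] by auto
  have "y \<oplus> z = (\<Oplus>i\<in>I. n i \<otimes> w i \<oplus> m i \<otimes> w i)"
    unfolding n m by (rule finsum_addf[symmetric]) (use w c in auto)
  also have "\<dots> = (\<Oplus>i\<in>I. (n i \<oplus> m i) \<otimes> w i)"
    by (rule finsum_cong') (use w c in \<open>auto simp: Pi_iff l_distr\<close>)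
  finally have "y \<oplus> z = (\<Oplus>i\<in>I. (n i \<oplus> m i) \<otimes> w i)" .
  moreover have "(\<lambda>i. n i \<oplus> m i) \<in> I \<rightarrow> A" using n m subringE(7)[OF A] by auto
  ultimately show ?thesis using lincombsI by blast
qed

lemma lincombs_smult:
  assumes w: "w \<in> I \<rightarrow> carrier R" "finite I" and "c \<in> A" "y \<in> lincombs A I w"
  shows "c \<otimes> y \<in> lincombs A I w"
proof -
  obtain n where n: "n \<in> I \<rightarrow> A" "y = (\<Oplus>i\<in>I. n i \<otimes> w i)"
    using assms(4) unfolding lincombs_def by auto
  have c: "n \<in> I \<rightarrow> carrier R" "c \<in> carrier R"
    using n(1) subringE(1)[OF A] assms(3) by auto
  have "c \<otimes> y = (\<Oplus>i\<in>I. c \<otimes> (n i \<otimes> w i))"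
    unfolding n by (rule finsum_rdistr) (use w c in auto)
  also have "\<dots> = (\<Oplus>i\<in>I. (c \<otimes> n i) \<otimes> w i)"
    by (rule finsum_cong') (use w c in \<open>auto simp: Pi_iff m_assoc\<close>)
  finally have "c \<otimes> y = (\<Oplus>i\<in>I. (c \<otimes> n i) \<otimes> w i)" .
  moreover have "(\<lambda>i. c \<otimes> n i) \<in> I \<rightarrow> A" using n subringE(6)[OF A] assms by auto
  ultimately show ?thesis using lincombsI by blast
qed

lemma lincombs_zero: "w \<in> I \<rightarrow> carrier R \<Longrightarrow> \<zero> \<in> lincombs A I w"
proof -
  assume w: "w \<in> I \<rightarrow> carrier R"
  have "(\<Oplus>i\<in>I. \<zero> \<otimes> w i) = (\<Oplus>i\<in>I. \<zero>)" by (rule finsum_cong') (use w in \<open>auto simp: Pi_iff\<close>)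
  then have "\<zero> = (\<Oplus>i\<in>I. \<zero> \<otimes> w i)" by simp
  moreover have "(\<lambda>i. \<zero>) \<in> I \<rightarrow> A" using subringE(2)[OF A] by auto
  ultimately show ?thesis using lincombsI by blast
qed

lemma lincombs_generator: 
  assumes "w \<in> I \<rightarrow> carrier R" "finite I" "i \<in> I"
  shows "w i \<in> lincombs A I w"
proof -
  have "(\<Oplus>j\<in>I. (if i = j then \<one> else \<zero>) \<otimes> w j) = (\<Oplus>j\<in>I. if i = j then w j else \<zero>)"
    by (rule finsum_cong') (use assms in \<open>auto simp: Pi_iff\<close>)
  also have "\<dots> = w i" by (rule finsum_singleton) (use assms in auto)
  finally have "w i = (\<Oplus>j\<in>I. (if i = j then \<one> else \<zero>) \<otimes> w j)" ..
  moreover have "(\<lambda>j. if i = j then \<one> else \<zero>) \<in> I \<rightarrow> A" using subringE(2,3)[OF A] by auto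
  ultimately show ?thesis using lincombsI by blast
qed

text \<open>Expanding both factors leaves only monomials with exponents below \<open>m\<close> and
  \<open>n\<close>. These monomials generate the finite module on which the sum and the product of
  two integral elements will act.\<close>

lemma poly_values_mult_in_lincombs:
  assumes x: "x \<in> carrier R" and y: "y \<in> carrier R"
  assumes "q \<in> poly_values A x m" "r \<in> poly_values A y n"
  shows "q \<otimes> r \<in> lincombs A ({..<m} \<times> {..<n}) (\<lambda>(i, j). x [^] i \<otimes> y [^] j)"
    (is "_ \<in> ?T")
proof -
  let ?I = "{..<m} \<times> {..<n}" and ?w = "\<lambda>(i::nat, j::nat). x [^] i \<otimes> y [^] j"
  have w: "?w \<in> ?I \<rightarrow> carrier R" "finite ?I" using x y by auto
  have A': "a \<in> carrier R" if "a \<in> A" for a using that subringE(1)[OF A] by auto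
  \<comment> \<open>The second factor is expanded with the power of \<open>x\<close> held fixed; the
    induction on the first factor comes afterwards and uses this claim for each of its
    terms.\<close>
  have 1: "x [^] i \<otimes> s \<in> ?T" if "i < m" "s \<in> poly_values A y d" "d \<le> n" for i s d
    using that
  proof (induction d arbitrary: s)
    case 0
    then show ?case using lincombs_zero[OF w(1)] x by simp
  next
    case (Suc d)
    then obtain b s' where s: "s = b \<otimes> y [^] d \<oplus> s'" "b \<in> A" "s' \<in> poly_values A y d" by auto
    have c: "x [^] i \<in> carrier R" "y [^] d \<in> carrier R" "b \<in> carrier R" "s' \<in> carrier R"
      using x y A'[OF s(2)] poly_values_carrier[OF A y s(3)] by auto
    have "x [^] i \<otimes> s = b \<otimes> ?w (i, d) \<oplus> x [^] i \<otimes> s'"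
      unfolding s prod.case using c by algebra
    moreover have "b \<otimes> ?w (i, d) \<in> ?T"
      by (intro lincombs_smult lincombs_generator w s) (use Suc.prems in auto)
    ultimately show ?case using lincombs_add[OF w(1)] Suc s(3) by simp
  qed
  have "p \<otimes> r \<in> ?T" if "p \<in> poly_values A x d" "d \<le> m" for p d
    using that
  proof (induction d arbitrary: p)
    case 0
    then show ?case using lincombs_zero[OF w(1)] poly_values_carrier[OF A y assms(4)] by simp
  next
    case (Suc d)
    then obtain a p' where p: "p = a \<otimes> x [^] d \<oplus> p'" "a \<in> A" "p' \<in> poly_values A x d" by auto
    have c: "x [^] d \<in> carrier R" "a \<in> carrier R" "p' \<in> carrier R" "r \<in> carrier R"
      using x A'[OF p(2)] poly_values_carrier[OF A x p(3)] poly_values_carrier[OF A y assms(4)] by auto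
    have "p \<otimes> r = a \<otimes> (x [^] d \<otimes> r) \<oplus> p' \<otimes> r"
      unfolding p using c by algebra
    moreover have "a \<otimes> (x [^] d \<otimes> r) \<in> ?T"
      by (intro lincombs_smult w p 1[OF _ assms(4)]) (use Suc.prems in auto)
    ultimately show ?case using lincombs_add[OF w(1)] Suc p(3) by simp
  qed
  then show ?thesis using assms(3) by auto
qed

text \<open>The boundary \<open>k = m\<close> is what matters: there the monic equation rewrites the
  power by lower ones. Multiplying a generator by \<open>x\<close> or \<open>y\<close> never leads
  beyond this boundary.\<close>

lemma pow_le_in_poly_values:
  assumes x: "x \<in> carrier R" and "\<zero> \<in> monic_values A x m" "k \<le> m"
  shows "x [^] k \<in> poly_values A x m"
proof (cases "k = m")
  case True
  obtain q where q: "\<zero> = x [^] m \<oplus> q" "q \<in> poly_values A x m"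
    using assms(2) unfolding monic_values_def by auto
  then have "x [^] m = \<ominus> q"
    using poly_values_carrier[OF A x q(2)] x by (metis minus_equality nat_pow_closed)
  then show ?thesis using True poly_values_uminus[OF A x q(2)] by simp
next
  case False
  then show ?thesis using pow_in_poly_values[OF A x] assms by simp
qed

text \<open>The monomials in \<open>x\<close> and \<open>y\<close> below the degrees of the two
  equations span a module that contains one. Multiplication by \<open>x\<close> or by
  \<open>y\<close> raises an exponent by one, and a boundary power is reduced by its equation, so
  the module is stable under \<open>x \<oplus> y\<close> and \<open>x \<otimes> y\<close>.\<close>

lemma monic_value_zero_add_mult:
  assumes x: "x \<in> carrier R" and y: "y \<in> carrier R"
    and zx: "\<zero> \<in> monic_values A x m" and zy: "\<zero> \<in> monic_values A y n"
  shows "\<exists>d. \<zero> \<in> monic_values A (x \<oplus> y) d" "\<exists>d. \<zero> \<in> monic_values A (x \<otimes> y) d"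
proof -
  have "(\<exists>d. \<zero> \<in> monic_values A (x \<oplus> y) d) \<and> (\<exists>d. \<zero> \<in> monic_values A (x \<otimes> y) d)"
  proof (cases "m = 0 \<or> n = 0")
    \<comment> \<open>A monic equation of degree 0 says that one equals zero, and then degree 0
      serves for every element. Positive degrees are needed in the other case, so that the index
      \<open>(0, 0)\<close> of the generator one exists.\<close>
    case True
    moreover have "\<one> = \<zero>" if "\<zero> \<in> monic_values A z 0" for z
      using that unfolding monic_values_def by auto
    ultimately have "\<one> = \<zero>" using zx zy by blast
    then have "\<zero> \<in> monic_values A z 0" if "z \<in> carrier R" for z
      using that unfolding monic_values_def by auto
    then show ?thesis using x y by blast
  next
    case False
    let ?I = "{..<m} \<times> {..<n}" and ?w = "\<lambda>(i::nat, j::nat). x [^] i \<otimes> y [^] j"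
    let ?T = "lincombs A ?I ?w"
    have w: "?w \<in> ?I \<rightarrow> carrier R" "finite ?I" "(0, 0) \<in> ?I" "?w (0, 0) = \<one>" using x y False by auto
    have T: "x [^] i \<otimes> y [^] j \<in> ?T" if "i \<le> m" "j \<le> n" for i j :: nat
      by (rule poly_values_mult_in_lincombs[OF x y pow_le_in_poly_values pow_le_in_poly_values])
        (use x y zx zy that in auto)
    have add: "(x \<oplus> y) \<otimes> ?w i \<in> ?T" if iI: "i \<in> ?I" for i
    proof -
      obtain a b where i: "i = (a, b)" "a < m" "b < n" using iI by auto
      have "x [^] a \<in> carrier R" "y [^] b \<in> carrier R" using x y by auto
      then have "(x \<oplus> y) \<otimes> ?w i = x [^] Suc a \<otimes> y [^] b \<oplus> x [^] a \<otimes> y [^] Suc b"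
        unfolding i prod.case nat_pow_Suc using x y by algebra
      moreover have "x [^] Suc a \<otimes> y [^] b \<in> ?T" "x [^] a \<otimes> y [^] Suc b \<in> ?T"
        using T i by (auto simp only: Suc_leI less_imp_le)
      ultimately show ?thesis using lincombs_add[OF w(1)] by metis
    qed
    have mult: "(x \<otimes> y) \<otimes> ?w i \<in> ?T" if iI: "i \<in> ?I" for i
    proof -
      obtain a b where i: "i = (a, b)" "a < m" "b < n" using iI by auto
      have "x [^] a \<in> carrier R" "y [^] b \<in> carrier R" using x y by auto
      then have "(x \<otimes> y) \<otimes> ?w i = x [^] Suc a \<otimes> y [^] Suc b"
        unfolding i prod.case nat_pow_Suc using x y by algebra
      then show ?thesis using T[of "Suc a" "Suc b"] i by simp
    qed
    show ?thesis
    proof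
      show "\<exists>d. \<zero> \<in> monic_values A (x \<oplus> y) d"
        by (rule monic_value_zero_of_stable[OF A _ w(2,3,1,4) add]) (use x y in auto)
      show "\<exists>d. \<zero> \<in> monic_values A (x \<otimes> y) d"
        by (rule monic_value_zero_of_stable[OF A _ w(2,3,1,4) mult]) (use x y in auto)
    qed
  qed
  then show "\<exists>d. \<zero> \<in> monic_values A (x \<oplus> y) d" "\<exists>d. \<zero> \<in> monic_values A (x \<otimes> y) d" by auto
qed

lemma monic_value_zero_base:
  assumes "x \<in> A"
  shows "\<zero> \<in> monic_values A x 1"
proof -
  have x: "x \<in> carrier R" using assms subringE(1)[OF A] by auto
  have "\<ominus> x \<otimes> x [^] (0::nat) \<oplus> \<zero> \<in> poly_values A x (Suc 0)"
    by (rule poly_values_SucI[OF A x]) (use subringE(5)[OF A assms] in auto)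
  then have "\<ominus> x \<in> poly_values A x (Suc 0)" using x by simp
  moreover have "\<zero> = x [^] (1::nat) \<oplus> \<ominus> x" using x by (simp add: r_neg)
  ultimately show ?thesis unfolding monic_values_def One_nat_def by blast
qed

end

lemma poly_values_base_mono: "A \<subseteq> A' \<Longrightarrow> q \<in> poly_values A x d \<Longrightarrow> q \<in> poly_values A' x d"
  by (induction d arbitrary: q) (simp, fastforce)

end

context domain
begin

text \<open>A nonempty polynomial over \<open>A\<close> must have a nonzero leading coefficient. In
  a domain one is nonzero, so every list \<open>p\<close> over \<open>A\<close> yields the
  polynomial \<open>\<one> # p\<close>, whose tail supplies the lower part of a monic
  equation.\<close>

lemma integral_over_iff:
  assumes "subring A R" "x \<in> carrier R"
  shows "integral_over R A x \<longleftrightarrow> (\<exists>d. \<zero> \<in> monic_values A x d)"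
proof
  assume "integral_over R A x"
  then obtain P where P: "polynomial A P" "P \<noteq> []" "lead_coeff P = \<one>" "eval P x = \<zero>"
    by (auto simp: integral_over_def univ_poly_carrier[symmetric])
  then obtain p where p: "P = \<one> # p" by (cases P) auto
  have "set p \<subseteq> A" using P(1) unfolding p polynomial_def by auto
  then have "eval p x \<in> poly_values A x (length p)" using poly_values_eq_eval by auto
  moreover have "\<zero> = x [^] length p \<oplus> eval p x"
    using P(4) assms(2) unfolding p by simp
  ultimately show "\<exists>d. \<zero> \<in> monic_values A x d" unfolding monic_values_def by blast
next
  assume "\<exists>d. \<zero> \<in> monic_values A x d"
  then obtain p where p: "set p \<subseteq> A" "x [^] length p \<oplus> eval p x = \<zero>"
    unfolding monic_values_def poly_values_eq_eval by auto
  have "polynomial A (\<one> # p)"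
    using p(1) subringE(3)[OF assms(1)] unfolding polynomial_def by simp
  moreover have "eval (\<one> # p) x = \<zero>" using p assms(2) by simp
  ultimately show "integral_over R A x"
    unfolding integral_over_def
    by (intro bexI[of _ "\<one> # p"] conjI) (simp_all only: univ_poly_carrier list.sel list.distinct not_False_eq_True)
qed

lemma subring_integral_closure:
  assumes A: "subring A R"
  shows "subring {x \<in> carrier R. integral_over R A x} R"
proof -
  define C where "C = {x \<in> carrier R. integral_over R A x}"
  have C: "x \<in> C \<longleftrightarrow> x \<in> carrier R \<and> (\<exists>d. \<zero> \<in> monic_values A x d)" for x
    unfolding C_def using integral_over_iff[OF A] by blast
  have base: "a \<in> C" if "a \<in> A" for a
    unfolding C using monic_value_zero_base[OF A that] subringE(1)[OF A] that by blast
  have mult: "a \<otimes> b \<in> C" if "a \<in> C" "b \<in> C" for a b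
    using that monic_value_zero_add_mult(2)[OF A] unfolding C by (meson m_closed)
  have "subring C R"
  proof (rule subringI)
    show "\<one> \<in> C" using base subringE(3)[OF A] by blast
    show "a \<otimes> b \<in> C" if "a \<in> C" "b \<in> C" for a b using mult that .
    show "a \<oplus> b \<in> C" if "a \<in> C" "b \<in> C" for a b
      using that monic_value_zero_add_mult(1)[OF A] unfolding C by (meson a_closed)
    fix a assume a: "a \<in> C"
    then have "\<ominus> a = (\<ominus> \<one>) \<otimes> a" using C by (simp add: l_minus)
    then show "\<ominus> a \<in> C"
      using mult[OF base a] subringE(3,5)[OF A] by metis
  qed (use C in blast)
  then show ?thesis unfolding C_def .
qed

end

section \<open>Split polynomials, primes avoiding a multiplicative set, and the extension of
  retractions\<close>

lemma (in cring) monic_valuesI: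
  "set p \<subseteq> A \<Longrightarrow> length p = d \<Longrightarrow> y = x [^] d \<oplus> eval p x \<Longrightarrow> y \<in> monic_values A x d"
  unfolding monic_values_def poly_values_eq_eval by auto

text \<open>\<open>splitted\<close> only counts roots with multiplicity, whereas reduction modulo a
  prime requires a product formula for values. Splitting off a root \<open>c\<close> leaves a
  divisor of \<open>p\<close>, which is again split and has the same leading coefficient.\<close>

lemma (in field) splitted_eval:
  assumes "p \<in> carrier (poly_ring R)" "p \<noteq> []" "splitted p"
  shows "\<exists>cs. set cs \<subseteq> carrier R \<and> (\<forall>x\<in>carrier R.
    eval p x = lead_coeff p \<otimes> foldr (\<lambda>c y. (x \<ominus> c) \<otimes> y) cs \<one>)"
  using assms
proof (induction "degree p" arbitrary: p)
  case 0
  then obtain a where p: "p = [a]" by (cases p) auto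
  have "a \<in> carrier R" using 0 unfolding p univ_poly_carrier[symmetric] polynomial_def by auto
  then have "\<forall>x\<in>carrier R. eval p x = lead_coeff p \<otimes> foldr (\<lambda>c y. (x \<ominus> c) \<otimes> y) [] \<one>"
    unfolding p by simp
  then show ?case by (metis empty_subsetI list.set(1))
next
  case (Suc n)
  interpret UP: domain "poly_ring R"
    using univ_poly_is_domain[OF carrier_is_subring] .
  have "roots p \<noteq> {#}" using Suc unfolding splitted_def by auto
  then obtain c where "c \<in># roots p" by blast
  then have c: "is_root p c" using roots_mem_iff_is_root[OF Suc.prems(1)] by blast
  then have c': "c \<in> carrier R" unfolding is_root_def by simp
  let ?l = "[\<one>, \<ominus> c]"
  have l: "?l \<in> carrier (poly_ring R)"
    using c' unfolding univ_poly_carrier[symmetric] polynomial_def by auto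
  obtain q where q: "q \<in> carrier (poly_ring R)" "p = ?l \<otimes>\<^bsub>poly_ring R\<^esub> q"
    using is_root_imp_pdivides[OF Suc.prems(1) c] unfolding pdivides_def by auto
  then have p: "p = poly_mult ?l q" by (simp add: univ_poly_mult)
  have qn: "q \<noteq> []" using p Suc.prems(2) poly_mult_zero(2)[of ?l] c' by auto
  have pol: "polynomial (carrier R) ?l" "polynomial (carrier R) q"
    using l q(1) by (simp_all add: univ_poly_carrier)
  have qd: "degree q = n"
    using poly_mult_degree_eq[OF carrier_is_subring pol] qn Suc.hyps(2) unfolding p by simp
  have lead: "lead_coeff p = lead_coeff q"
  proof -
    have "lead_coeff q \<in> carrier R" using pol(2) qn unfolding polynomial_def by (cases q) auto
    then show ?thesis
      using poly_mult_lead_coeff[OF carrier_is_subring pol _ qn] unfolding p by simp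
  qed
  have "q pdivides p"
    unfolding pdivides_def using q l UP.m_comm by (auto simp: factor_def)
  then have "splitted q" using pdivides_imp_splitted[OF q(1) Suc.prems] by blast
  then obtain cs where cs: "set cs \<subseteq> carrier R" "\<And>x. x \<in> carrier R \<Longrightarrow>
    eval q x = lead_coeff q \<otimes> foldr (\<lambda>c y. (x \<ominus> c) \<otimes> y) cs \<one>"
    using Suc.hyps(1)[OF qd[symmetric] q(1) qn] by blast
  have "eval p x = lead_coeff p \<otimes> foldr (\<lambda>c y. (x \<ominus> c) \<otimes> y) (c # cs) \<one>" if x: "x \<in> carrier R" for x
  proof -
    have f: "foldr (\<lambda>c y. (x \<ominus> c) \<otimes> y) cs \<one> \<in> carrier R"
      using cs(1) x by (induction cs) auto
    have k: "lead_coeff q \<in> carrier R" using pol(2) qn unfolding polynomial_def by (cases q) auto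
    have "eval p x = eval ?l x \<otimes> eval q x"
      unfolding p by (rule eval_poly_mult) (use x c' pol(2) polynomial_in_carrier[OF carrier_is_subring] in auto)
    also have "eval ?l x = x \<ominus> c" using x c' by (simp add: minus_eq)
    finally show ?thesis
      unfolding cs(2)[OF x] lead using x c' k f by (simp add: m_lcomm)
  qed
  then show ?case using cs(1) c' by (intro exI[of _ "c # cs"]) auto
qed

text \<open>The prime is a maximal member, by Zorn's lemma, of the set of ideals disjoint from
  \<open>M\<close>. The last conclusion preserves what maximality says about elements outside
  \<open>P\<close>: primality and disjointness alone would not force the kernel of a retraction into
  \<open>P\<close>.\<close>

lemma (in cring) exists_primeideal_disjoint:
  assumes M: "M \<subseteq> carrier R" "\<one> \<in> M" "\<zero> \<notin> M"
    and mult: "\<And>a b. a \<in> M \<Longrightarrow> b \<in> M \<Longrightarrow> a \<otimes> b \<in> M"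
  obtains P where "primeideal P R" "P \<inter> M = {}"
    "\<And>q. q \<in> carrier R \<Longrightarrow> q \<notin> P \<Longrightarrow> \<exists>p\<in>P. \<exists>b\<in>carrier R. p \<oplus> b \<otimes> q \<in> M"
proof -
  define F where "F = {I. ideal I R \<and> I \<inter> M = {}}"
  have "\<exists>P\<in>F. \<forall>J\<in>F. P \<subseteq> J \<longrightarrow> J = P"
  proof (rule subset_Zorn_nonempty)
    have "{\<zero>} \<in> F" unfolding F_def using zeroideal M(3) by auto
    then show "F \<noteq> {}" by blast
    fix C assume C: "C \<noteq> {}" "subset.chain F C"
    then have "subset.chain {I. ideal I R} C" unfolding F_def subset.chain_def by auto
    then have "ideal (\<Union>C) R" using chain_Union_is_ideal[of C] C(1) by simp
    moreover have "\<Union>C \<inter> M = {}" using C(2) unfolding F_def subset.chain_def by blast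
    ultimately show "\<Union>C \<in> F" unfolding F_def by blast
  qed
  then obtain P where PF: "P \<in> F" and maxF: "\<forall>J\<in>F. P \<subseteq> J \<longrightarrow> J = P" by (rule bexE)
  have P: "ideal P R" "P \<inter> M = {}" using PF unfolding F_def by simp_all
  have max: "J = P" if "ideal J R" "J \<inter> M = {}" "P \<subseteq> J" for J
    using maxF that unfolding F_def by simp
  interpret P: ideal P R by (rule P)
  have ex: "\<exists>p\<in>P. \<exists>b\<in>carrier R. p \<oplus> b \<otimes> q \<in> M" if q: "q \<in> carrier R" "q \<notin> P" for q
  proof -
    let ?J = "set_add R P (PIdl q)"
    have J: "ideal ?J R" using add_ideals[OF P(1) cgenideal_ideal[OF q(1)]] .
    have z: "\<zero> \<in> PIdl q"
      using additive_subgroup.zero_closed[OF ideal.axioms(1)[OF cgenideal_ideal[OF q(1)]]] .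
    have PX: "P \<subseteq> ?J"
    proof
      fix p assume p: "p \<in> P"
      then have "p = p \<oplus> \<zero>" using P.Icarr by simp
      then show "p \<in> ?J" unfolding set_add_def' using p z by blast
    qed
    have "q = \<zero> \<oplus> q" using q by simp
    then have "q \<in> ?J" unfolding set_add_def' using cgenideal_self[OF q(1)] P.zero_closed by blast
    then have "?J \<inter> M \<noteq> {}" using max[OF J _ PX] q(2) by blast
    then show ?thesis unfolding set_add_def' cgenideal_def by blast
  qed
  have "primeideal P R"
  proof (rule primeidealI[OF P(1) is_cring])
    show "carrier R \<noteq> P" using P(2) M by blast
    fix x y assume xy: "x \<in> carrier R" "y \<in> carrier R" "x \<otimes> y \<in> P"
    show "x \<in> P \<or> y \<in> P"
    proof (rule ccontr)
      assume "\<not> (x \<in> P \<or> y \<in> P)"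
      then obtain p b p' b' where pb: "p \<in> P" "b \<in> carrier R" "p \<oplus> b \<otimes> x \<in> M"
        "p' \<in> P" "b' \<in> carrier R" "p' \<oplus> b' \<otimes> y \<in> M" using ex xy by meson
      have pc: "p \<in> carrier R" "p' \<in> carrier R" using pb P.Icarr by auto
      \<comment> \<open>A product of two elements of \<open>M\<close> would lie in \<open>P\<close>:
        each term of its expansion has \<open>p\<close>, \<open>p'\<close> or
        \<open>x \<otimes> y\<close> as a factor.\<close>
      have "(p \<oplus> b \<otimes> x) \<otimes> (p' \<oplus> b' \<otimes> y) =
          (p' \<oplus> b' \<otimes> y) \<otimes> p \<oplus> ((b \<otimes> x) \<otimes> p' \<oplus> (b \<otimes> b') \<otimes> (x \<otimes> y))"
        using pc pb(2,5) xy(1,2) by algebra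
      moreover have "\<dots> \<in> P"
        using P.I_l_closed[OF pb(1), of "p' \<oplus> b' \<otimes> y"] P.I_l_closed[OF pb(4), of "b \<otimes> x"]
          P.I_l_closed[OF xy(3), of "b \<otimes> b'"] pb(2,5) xy(1,2) pc
        by (intro P.a_closed) auto
      ultimately show False using mult[OF pb(3,6)] P(2) by auto
    qed
  qed
  then show thesis using that P(2) ex by blast
qed


text \<open>The witness sends \<open>b\<close> to the only element of \<open>B'\<close> that is congruent to \<open>b\<close> modulo a prime of \<open>B\<close>
  that is maximal among the ideals disjoint from \<open>{a \<in> A. \<tau> a \<noteq> \<zero>}\<close>.\<close>

lemma (in field) integral_closure_retraction:
  assumes A: "subring A R" and A': "subring A' R" "A' \<subseteq> A"
    and \<tau>: "\<tau> \<in> A \<rightarrow> A'" "\<And>a. a \<in> A' \<Longrightarrow> \<tau> a = a"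
      "\<And>a b. a \<in> A \<Longrightarrow> b \<in> A \<Longrightarrow> \<tau> (a \<oplus> b) = \<tau> a \<oplus> \<tau> b"
      "\<And>a b. a \<in> A \<Longrightarrow> b \<in> A \<Longrightarrow> \<tau> (a \<otimes> b) = \<tau> a \<otimes> \<tau> b"
    and splitted: "\<And>p. p \<in> carrier (univ_poly R A') \<Longrightarrow> splitted p"
    and B_def: "B = {x \<in> carrier R. integral_over R A x}"
    and B'_def: "B' = {x \<in> carrier R. integral_over R A' x}"
  obtains \<pi> where "\<pi> \<in> B \<rightarrow> B'" "\<And>b. b \<in> B' \<Longrightarrow> \<pi> b = b" "\<And>a. a \<in> A \<Longrightarrow> \<pi> a \<in> A'"
    "\<And>a b. a \<in> B \<Longrightarrow> b \<in> B \<Longrightarrow> \<pi> (a \<oplus> b) = \<pi> a \<oplus> \<pi> b"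
    "\<And>a b. a \<in> B \<Longrightarrow> b \<in> B \<Longrightarrow> \<pi> (a \<otimes> b) = \<pi> a \<otimes> \<pi> b"
proof -
  have B: "subring B R" unfolding B_def by (rule subring_integral_closure[OF A])
  have B': "subring B' R" unfolding B'_def by (rule subring_integral_closure[OF A'(1)])
  have Bc: "b \<in> carrier R" if "b \<in> B" for b using that subringE(1)[OF B] by blast
  have Ac: "a \<in> carrier R" if "a \<in> A" for a using that subringE(1)[OF A] by blast
  have intB: "b \<in> B \<longleftrightarrow> b \<in> carrier R \<and> (\<exists>d. \<zero> \<in> monic_values A b d)" for b
    unfolding B_def using integral_over_iff[OF A] by blast
  have intB': "b \<in> B' \<longleftrightarrow> b \<in> carrier R \<and> (\<exists>d. \<zero> \<in> monic_values A' b d)" for b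
    unfolding B'_def using integral_over_iff[OF A'(1)] by blast
  have AB: "a \<in> B" if "a \<in> A" for a
    unfolding intB using that Ac monic_value_zero_base[OF A that] by blast
  have AB': "a \<in> B'" if "a \<in> A'" for a
    unfolding intB' using that Ac A'(2) monic_value_zero_base[OF A'(1) that] by blast
  have B'B: "b \<in> B" if b: "b \<in> B'" for b
  proof -
    obtain d q where "\<zero> = b [^] d \<oplus> q" "q \<in> poly_values A' b d"
      using b unfolding intB' monic_values_def by auto
    then have "\<zero> \<in> monic_values A b d"
      unfolding monic_values_def using poly_values_base_mono[OF A'(2)] by blast
    then show ?thesis using b unfolding intB intB' by blast
  qed
  have Bpow: "b [^] d \<in> B" if "b \<in> B" for b and d :: nat
    using that subringE(3,6)[OF B] by (induction d) auto
  have Apow: "b [^] d \<in> A" if "b \<in> A" for b and d :: nat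
    using that subringE(3,6)[OF A] by (induction d) auto
  have Bpoly: "q \<in> B" if "b \<in> B" "q \<in> poly_values A b d" for b q d
    using that(2) subringE(2)[OF B] subringE(6,7)[OF B] AB Bpow[OF that(1)]
    by (induction d arbitrary: q) auto
  define S where "S = R \<lparr>carrier := B\<rparr>"
  interpret S: cring S unfolding S_def using subcring_iff[OF subringE(1)[OF B]] subcringI'[OF B] by simp
  have \<tau>A: "\<tau> a \<in> A'" "\<tau> a \<in> A" if "a \<in> A" for a using \<tau>(1) A'(2) that by blast+
  have \<tau>0: "\<tau> \<zero> = \<zero>" and \<tau>1: "\<tau> \<one> = \<one>" using \<tau>(2) subringE(2,3)[OF A'(1)] by auto
  \<comment> \<open>The complement in \<open>A\<close> of the kernel of \<open>\<tau>\<close>,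
    multiplicatively closed because products of nonzero elements are nonzero in a field.
    Disjointness from \<open>M\<close> puts \<open>P \<inter> A\<close> inside the kernel.\<close>
  define M where "M = {a \<in> A. \<tau> a \<noteq> \<zero>}"
  have M: "M \<subseteq> carrier S" "\<one>\<^bsub>S\<^esub> \<in> M" "\<zero>\<^bsub>S\<^esub> \<notin> M"
    using AB \<tau>0 \<tau>1 subringE(3)[OF A] unfolding M_def S_def by auto
  have Mmult: "a \<otimes>\<^bsub>S\<^esub> b \<in> M" if "a \<in> M" "b \<in> M" for a b
  proof -
    have "\<tau> a \<in> carrier R" "\<tau> b \<in> carrier R" using that \<tau>A Ac unfolding M_def by auto
    then show ?thesis
      using that subringE(6)[OF A] \<tau>(4)[of a b] integral_iff[of "\<tau> a" "\<tau> b"] unfolding M_def S_def by simp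
  qed
  obtain P where P: "primeideal P S" "P \<inter> M = {}"
    and Pmax: "\<And>q. q \<in> carrier S \<Longrightarrow> q \<notin> P \<Longrightarrow> \<exists>p\<in>P. \<exists>b\<in>carrier S. p \<oplus>\<^bsub>S\<^esub> b \<otimes>\<^bsub>S\<^esub> q \<in> M"
    using S.exists_primeideal_disjoint[OF M Mmult] by metis
  interpret P: primeideal P S by (rule P(1))
  define D where "D = S Quot P"
  interpret D: domain D unfolding D_def by (rule P.quotient_is_domain)
  define H where "H = a_r_coset S P"
  interpret H: ring_hom_cring S D H
    unfolding D_def H_def by (rule P.rcos_ring_hom_cring)
  have Hc: "H b \<in> carrier D" if "b \<in> B" for b using that unfolding S_def by (intro H.hom_closed) (simp add: S_def)
  have Hadd: "H (a \<oplus> b) = H a \<oplus>\<^bsub>D\<^esub> H b" if "a \<in> B" "b \<in> B" for a b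
    using H.hom_add[of a b] that unfolding S_def by simp
  have Hmult: "H (a \<otimes> b) = H a \<otimes>\<^bsub>D\<^esub> H b" if "a \<in> B" "b \<in> B" for a b
    using H.hom_mult[of a b] that unfolding S_def by simp
  have H0: "H \<zero> = \<zero>\<^bsub>D\<^esub>" using H.hom_zero unfolding S_def by simp
  have H1: "H \<one> = \<one>\<^bsub>D\<^esub>" using H.hom_one unfolding S_def by simp
  have Hpow: "H (b [^] d) = H b [^]\<^bsub>D\<^esub> d" if "b \<in> B" for b and d :: nat
    using that H1 Hmult Bpow by (induction d) auto
  have Hker: "H b = \<zero>\<^bsub>D\<^esub> \<longleftrightarrow> b \<in> P" if "b \<in> B" for b
  proof -
    have "b \<in> carrier S" using that unfolding S_def by simp
    then show ?thesis
      unfolding H_def D_def FactRing_def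
      using P.rcos_const_imp_mem[of b] P.a_rcos_const[of b] by auto
  qed
  have Hinv: "H (\<ominus> b) = \<ominus>\<^bsub>D\<^esub> H b" if "b \<in> B" for b
  proof -
    have "H b \<oplus>\<^bsub>D\<^esub> H (\<ominus> b) = H (b \<oplus> \<ominus> b)" using Hadd[of b "\<ominus> b"] that subringE(5)[OF B] by simp
    also have "\<dots> = \<zero>\<^bsub>D\<^esub>" using H0 Bc[OF that] by (simp add: r_neg)
    finally show ?thesis
      using Hc that subringE(5)[OF B that] by (metis D.a_comm D.minus_equality)
  qed
  \<comment> \<open>The kernel lies in \<open>P\<close>. Otherwise maximality gives
    \<open>s = p \<oplus> b \<otimes> a\<close> in \<open>M\<close>, congruent to
    \<open>b \<otimes> a\<close> modulo \<open>P\<close>. Multiplying a monic equation of degree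
    \<open>m\<close> for \<open>b\<close> by the \<open>m\<close>-th power of \<open>a\<close> shows
    that \<open>s [^] m \<oplus> u\<close> lies in \<open>P\<close> for some \<open>u\<close> in the
    kernel. Then \<open>\<tau>\<close> kills this element of \<open>A\<close>, hence kills
    \<open>s [^] m\<close>, contradicting \<open>\<tau> s \<noteq> \<zero>\<close>.\<close>
  have ker\<tau>: "H a = \<zero>\<^bsub>D\<^esub>" if a: "a \<in> A" "\<tau> a = \<zero>" for a
  proof (rule ccontr)
    assume "H a \<noteq> \<zero>\<^bsub>D\<^esub>"
    then have "a \<notin> P" using Hker AB a by blast
    then obtain p b where pb: "p \<in> P" "b \<in> B" "p \<oplus> b \<otimes> a \<in> M"
      using Pmax[of a] AB[OF a(1)] unfolding S_def by auto
    define s where "s = p \<oplus> b \<otimes> a"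
    have s: "s \<in> A" "\<tau> s \<noteq> \<zero>" using pb(3) unfolding s_def M_def by auto
    have pB: "p \<in> B" using P.Icarr[OF pb(1)] unfolding S_def by simp
    have abB: "b \<otimes> a \<in> B" using pb(2) AB[OF a(1)] subringE(6)[OF B] by blast
    have Hs: "H s = H b \<otimes>\<^bsub>D\<^esub> H a"
      unfolding s_def using Hadd[OF pB abB] Hmult[OF pb(2) AB[OF a(1)]] Hker[OF pB] pb(1,2) Hc AB a(1) by simp
    have Hsd: "H a [^]\<^bsub>D\<^esub> d \<otimes>\<^bsub>D\<^esub> H b [^]\<^bsub>D\<^esub> d = H (s [^] d)" for d :: nat
      unfolding Hpow[OF AB[OF s(1)]] Hs
      using D.nat_pow_distrib[of "H b" "H a" d] Hc pb(2) AB[OF a(1)] D.m_comm by simp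
    \<comment> \<open>In each term of \<open>r\<close> the exponent of \<open>b\<close> is below
      \<open>d\<close>. Pairing every \<open>b\<close> with one \<open>a\<close> turns the term into
      a coefficient times a power of \<open>s\<close>, and at least one factor \<open>a\<close> is
      left over to place it in the kernel.\<close>
    have red: "\<exists>u\<in>A. \<tau> u = \<zero> \<and> H a [^]\<^bsub>D\<^esub> d \<otimes>\<^bsub>D\<^esub> H r = H u" if "r \<in> poly_values A b d" for r d
      using that
    proof (induction d arbitrary: r)
      case 0
      then show ?case using H0 \<tau>0 subringE(2)[OF A] by auto
    next
      case (Suc d)
      then obtain c r' where r: "r = c \<otimes> b [^] d \<oplus> r'" "c \<in> A" "r' \<in> poly_values A b d" by auto
      obtain u where u: "u \<in> A" "\<tau> u = \<zero>" "H a [^]\<^bsub>D\<^esub> d \<otimes>\<^bsub>D\<^esub> H r' = H u"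
        using Suc.IH[OF r(3)] by blast
      let ?u = "(c \<otimes> a) \<otimes> s [^] d \<oplus> a \<otimes> u"
      have mem: "c \<otimes> a \<in> A" "s [^] d \<in> A" "a \<otimes> u \<in> A" "(c \<otimes> a) \<otimes> s [^] d \<in> A"
        using a(1) r(2) u(1) s(1) subringE(6)[OF A] Apow by auto
      then have uA: "?u \<in> A" using subringE(7)[OF A] by blast
      have tc: "\<tau> c \<in> carrier R" "\<tau> (s [^] d) \<in> carrier R" using \<tau>A Ac r(2) mem(2) by blast+
      have "\<tau> ?u = \<zero>"
        using \<tau>(3)[OF mem(4,3)] \<tau>(4)[OF mem(1,2)] \<tau>(4)[OF r(2) a(1)] \<tau>(4)[OF a(1) u(1)] a(2) u(2) tc
        by simp
      moreover have "H a [^]\<^bsub>D\<^esub> Suc d \<otimes>\<^bsub>D\<^esub> H r = H ?u"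
      proof -
        have r'B: "r' \<in> B" using Bpoly[OF pb(2) r(3)] .
        have cbB: "c \<otimes> b [^] d \<in> B" using AB[OF r(2)] Bpow[OF pb(2)] subringE(6)[OF B] by blast
        have car: "H a \<in> carrier D" "H b \<in> carrier D" "H c \<in> carrier D" "H r' \<in> carrier D"
          using Hc AB a(1) pb(2) r(2) r'B by auto
        have pw: "H a [^]\<^bsub>D\<^esub> d \<in> carrier D" "H b [^]\<^bsub>D\<^esub> d \<in> carrier D" using car by auto
        have "H r = H c \<otimes>\<^bsub>D\<^esub> H b [^]\<^bsub>D\<^esub> d \<oplus>\<^bsub>D\<^esub> H r'"
          unfolding r(1) Hadd[OF cbB r'B] Hmult[OF AB[OF r(2)] Bpow[OF pb(2)]] Hpow[OF pb(2)] ..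
        then have "H a [^]\<^bsub>D\<^esub> Suc d \<otimes>\<^bsub>D\<^esub> H r =
          (H c \<otimes>\<^bsub>D\<^esub> H a) \<otimes>\<^bsub>D\<^esub> (H a [^]\<^bsub>D\<^esub> d \<otimes>\<^bsub>D\<^esub> H b [^]\<^bsub>D\<^esub> d) \<oplus>\<^bsub>D\<^esub>
          H a \<otimes>\<^bsub>D\<^esub> (H a [^]\<^bsub>D\<^esub> d \<otimes>\<^bsub>D\<^esub> H r')"
          unfolding D.nat_pow_Suc using car pw by algebra
        also have "\<dots> = H (c \<otimes> a) \<otimes>\<^bsub>D\<^esub> H (s [^] d) \<oplus>\<^bsub>D\<^esub> H a \<otimes>\<^bsub>D\<^esub> H u"
          unfolding Hsd u(3) Hmult[OF AB[OF r(2)] AB[OF a(1)]] ..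
        also have "\<dots> = H ?u"
          unfolding Hadd[OF AB[OF mem(4)] AB[OF mem(3)]] Hmult[OF AB[OF mem(1)] AB[OF mem(2)]]
            Hmult[OF AB[OF a(1)] AB[OF u(1)]] ..
        finally show ?thesis .
      qed
      ultimately show ?case using uA by blast
    qed
    obtain m r where r: "\<zero> = b [^] m \<oplus> r" "r \<in> poly_values A b m"
      using pb(2) unfolding intB monic_values_def by auto
    obtain u where u: "u \<in> A" "\<tau> u = \<zero>" "H a [^]\<^bsub>D\<^esub> m \<otimes>\<^bsub>D\<^esub> H r = H u"
      using red[OF r(2)] by blast
    have rB: "r \<in> B" using Bpoly[OF pb(2) r(2)] .
    have sm: "s [^] m \<in> A" using Apow s(1) by blast
    have car: "H a [^]\<^bsub>D\<^esub> m \<in> carrier D" "H b [^]\<^bsub>D\<^esub> m \<in> carrier D" "H r \<in> carrier D"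
      using Hc AB a(1) pb(2) rB by auto
    have "\<zero>\<^bsub>D\<^esub> = H b [^]\<^bsub>D\<^esub> m \<oplus>\<^bsub>D\<^esub> H r"
      unfolding H0[symmetric] Hpow[OF pb(2), symmetric] Hadd[OF Bpow[OF pb(2)] rB, symmetric] r(1)[symmetric] ..
    then have "H a [^]\<^bsub>D\<^esub> m \<otimes>\<^bsub>D\<^esub> \<zero>\<^bsub>D\<^esub> =
        H a [^]\<^bsub>D\<^esub> m \<otimes>\<^bsub>D\<^esub> H b [^]\<^bsub>D\<^esub> m \<oplus>\<^bsub>D\<^esub> H a [^]\<^bsub>D\<^esub> m \<otimes>\<^bsub>D\<^esub> H r"
      using car D.r_distr by metis
    then have "H (s [^] m \<oplus> u) = \<zero>\<^bsub>D\<^esub>"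
      unfolding Hsd u(3) Hadd[OF AB[OF sm] AB[OF u(1)]] using car by simp
    moreover have suA: "s [^] m \<oplus> u \<in> A" using sm u(1) subringE(7)[OF A] by blast
    ultimately have "s [^] m \<oplus> u \<in> P" using Hker AB by blast
    then have "\<tau> (s [^] m \<oplus> u) = \<zero>" using P(2) suA unfolding M_def by blast
    moreover have "\<tau> (s [^] m \<oplus> u) = \<tau> (s [^] m)"
      using \<tau>(3)[OF sm u(1)] u(2) Ac \<tau>A(2)[OF sm] by simp
    moreover have "\<tau> (s [^] d) \<noteq> \<zero>" for d :: nat
      using Apow[OF s(1)] s \<tau>(4) \<tau>1 \<tau>A Ac integral_iff by (induction d) auto
    ultimately show False by simp
  qed
  \<comment> \<open>Since \<open>\<tau>\<close> is the identity on \<open>A'\<close>, the difference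
    of \<open>a\<close> and \<open>\<tau> a\<close> is in its kernel, so modulo \<open>P\<close>
    every coefficient may be replaced by its image.\<close>
  have H\<tau>: "H a = H (\<tau> a)" if a: "a \<in> A" for a
  proof -
    have t: "\<ominus> \<tau> a \<in> A'" "\<ominus> \<tau> a \<in> A" "\<tau> a \<in> carrier R"
      using subringE(5)[OF A'(1)] \<tau>A[OF a] A'(2) Ac by blast+
    have "\<tau> (a \<oplus> \<ominus> \<tau> a) = \<zero>" using \<tau>(3)[OF a t(2)] \<tau>(2)[OF t(1)] t(3) by (simp add: r_neg)
    then have "H (a \<oplus> \<ominus> \<tau> a) = \<zero>\<^bsub>D\<^esub>" using ker\<tau> a t(2) subringE(7)[OF A] by blast
    then have "H a \<oplus>\<^bsub>D\<^esub> \<ominus>\<^bsub>D\<^esub> H (\<tau> a) = \<zero>\<^bsub>D\<^esub>"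
      using Hadd[OF AB[OF a] AB[OF t(2)]] Hinv[OF AB[OF \<tau>A(2)[OF a]]] by simp
    then show ?thesis using Hc AB a \<tau>A(2)[OF a] D.r_right_minus_eq unfolding D.minus_eq[symmetric]
      by (metis D.minus_eq D.r_right_minus_eq)
  qed
  \<comment> \<open>A nonzero \<open>c\<close> of \<open>B'\<close> in \<open>P\<close> is excluded
    by an equation of least degree over \<open>A'\<close>. Its constant term lies in
    \<open>P \<inter> A'\<close>, where it must vanish because \<open>\<tau>\<close> fixes it;
    cancelling \<open>c\<close> then leaves a monic equation of smaller degree.\<close>
  have unique0: "c = \<zero>" if c: "c \<in> B'" "H c = \<zero>\<^bsub>D\<^esub>" for c
  proof (rule ccontr)
    assume c0: "c \<noteq> \<zero>"
    have cB: "c \<in> B" "c \<in> carrier R" using B'B c(1) Bc by auto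
    define m where "m = (LEAST m. \<zero> \<in> monic_values A' c m)"
    have m: "\<zero> \<in> monic_values A' c m"
      unfolding m_def by (rule LeastI_ex) (use c(1) intB' in blast)
    then obtain q where q: "set q \<subseteq> A'" "length q = m" "\<zero> = c [^] m \<oplus> eval q c"
      unfolding monic_values_def poly_values_eq_eval by auto
    have "m \<noteq> 0" using q by auto
    then obtain k where k: "m = Suc k" by (cases m) auto
    \<comment> \<open>Coefficient lists end with the constant term, so \<open>a\<close> is that
      term, and \<open>q'\<close> together with the leading one is the quotient of the remaining
      part by the variable.\<close>
    obtain q' a where qa: "q = q' @ [a]" "length q' = k"
      using q(2) unfolding k by (metis length_Suc_conv_rev)
    have aA: "a \<in> A'" "set q' \<subseteq> A'" "a \<in> A" "a \<in> carrier R" using q(1) A'(2) Ac unfolding qa by auto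
    have q'c: "set q' \<subseteq> carrier R" using aA(2) A'(2) Ac by blast
    have ev: "eval q' c \<in> B"
    proof (rule Bpoly[OF cB(1)])
      show "eval q' c \<in> poly_values A c k"
        unfolding poly_values_eq_eval using aA(2) A'(2) qa(2) by blast
    qed
    define w where "w = c [^] k \<oplus> eval q' c"
    have w: "w \<in> B" "w \<in> carrier R"
      using subringE(7)[OF B Bpow[OF cB(1)] ev] Bc unfolding w_def by auto
    have wca: "\<zero> = w \<otimes> c \<oplus> a"
      using q(3) unfolding qa eval_append_aux[OF q'c aA(4) cB(2)] k w_def nat_pow_Suc
      using cB(2) aA(4) ev Bc by (simp add: l_distr a_assoc)
    have "H (w \<otimes> c \<oplus> a) = H a"
      using Hadd[OF subringE(6)[OF B w(1) cB(1)] AB[OF aA(3)]] Hmult[OF w(1) cB(1)] c(2) Hc w(1) AB[OF aA(3)]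
      by simp
    then have "H a = \<zero>\<^bsub>D\<^esub>" using H0 wca by simp
    then have "a \<in> P" using Hker AB aA(3) by blast
    then have "a = \<zero>" using P(2) aA(1,3) \<tau>(2) unfolding M_def by auto
    then have "w \<otimes> c = \<zero>" using wca w(2) cB(2) m_closed r_zero by metis
    then have "w = \<zero>" using integral_iff w(2) cB(2) c0 by blast
    then have "\<zero> \<in> monic_values A' c k"
      unfolding w_def by (intro monic_valuesI[OF aA(2) qa(2)]) simp
    then have "m \<le> k" unfolding m_def by (rule Least_le)
    then show False using k by simp
  qed
  have unique: "c = c'" if c: "c \<in> B'" "c' \<in> B'" "H c = H c'" for c c'
  proof -
    have n: "\<ominus> c' \<in> B'" "c \<oplus> \<ominus> c' \<in> B'" using c subringE(5,7)[OF B'] by blast+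
    have "H (c \<oplus> \<ominus> c') = \<zero>\<^bsub>D\<^esub>"
      using Hadd[OF B'B[OF c(1)] B'B[OF n(1)]] Hinv[OF B'B[OF c(2)]] c(3) Hc[OF B'B[OF c(2)]]
      by (simp add: D.r_neg)
    then have "c \<oplus> \<ominus> c' = \<zero>" using unique0 n(2) by blast
    then show ?thesis using Bc B'B c by (metis minus_eq r_right_minus_eq)
  qed
  have exists: "\<exists>c\<in>B'. H c = H b" if b: "b \<in> B" for b
  proof -
    obtain q where q: "set q \<subseteq> A" "\<zero> = b [^] length q \<oplus> eval q b"
      using b unfolding intB monic_values_def poly_values_eq_eval by auto
    have bc: "b \<in> carrier R" using Bc b .
    have evB: "eval p b \<in> B" if "set p \<subseteq> A" for p
      by (rule Bpoly[OF b, of _ "length p"]) (use that in \<open>auto simp: poly_values_eq_eval\<close>)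
    have Hev: "H (eval p b) = H (eval (map \<tau> p) b)" if "set p \<subseteq> A" for p
      using that
    proof (induction p)
      case (Cons a p)
      have a: "a \<in> A" "\<tau> a \<in> A" and p: "set p \<subseteq> A" "set (map \<tau> p) \<subseteq> A" using Cons.prems \<tau>A by auto
      have m: "a \<otimes> b [^] length p \<in> B" "\<tau> a \<otimes> b [^] length p \<in> B"
        using AB a Bpow[OF b] subringE(6)[OF B] by blast+
      show ?case
        using Cons.IH[OF p(1)] Hadd[OF m(1) evB[OF p(1)]] Hadd[OF m(2) evB[OF p(2)]]
          Hmult[OF AB[OF a(1)] Bpow[OF b]] Hmult[OF AB[OF a(2)] Bpow[OF b]] H\<tau>[OF a(1)] by simp
    qed simp
    let ?p = "\<one> # map \<tau> q"
    have qA': "set (map \<tau> q) \<subseteq> A'" using q(1) \<tau>A by auto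
    have pA': "?p \<in> carrier (univ_poly R A')"
      unfolding univ_poly_carrier[symmetric] polynomial_def using qA' subringE(3)[OF A'(1)] by simp
    have "?p \<in> carrier (poly_ring R)"
      using carrier_polynomial_shell[OF A'(1) pA'] .
    then obtain cs where cs: "set cs \<subseteq> carrier R" "\<And>x. x \<in> carrier R \<Longrightarrow>
        eval ?p x = lead_coeff ?p \<otimes> foldr (\<lambda>c y. (x \<ominus> c) \<otimes> y) cs \<one>"
      using splitted_eval[of ?p] splitted[OF pA'] by auto
    have fc: "foldr (\<lambda>c y. (x \<ominus> c) \<otimes> y) l \<one> \<in> carrier R" if "x \<in> carrier R" "set l \<subseteq> carrier R" for x l
      using that by (induction l) auto
    have ev: "x [^] length q \<oplus> eval (map \<tau> q) x = foldr (\<lambda>c y. (x \<ominus> c) \<otimes> y) cs \<one>" if "x \<in> carrier R" for x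
      using cs(2)[OF that] fc[OF that cs(1)] that by simp
    \<comment> \<open>The roots come from the ambient field. Each satisfies the monic equation with
      coefficients \<open>map \<tau> q\<close> in \<open>A'\<close>, which is what membership in
      \<open>B'\<close> asks.\<close>
    have csB': "c \<in> B'" if c: "c \<in> set cs" for c
    proof -
      have cc: "c \<in> carrier R" using c cs(1) by blast
      have "foldr (\<lambda>d y. (c \<ominus> d) \<otimes> y) l \<one> = \<zero>" if "c \<in> set l" "set l \<subseteq> carrier R" for l
        using that fc[OF cc] cc by (induction l) (auto simp: minus_eq r_neg)
      then have "c [^] length q \<oplus> eval (map \<tau> q) c = \<zero>" using ev[OF cc] c cs(1) by simp
      then have "\<zero> \<in> monic_values A' c (length q)"
        by (intro monic_valuesI[OF qA']) simp_all
      then show ?thesis unfolding intB' using cc by blast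
    qed
    have "H (foldr (\<lambda>c y. (b \<ominus> c) \<otimes> y) cs \<one>) = \<zero>\<^bsub>D\<^esub>"
    proof -
      have "H (b [^] length q \<oplus> eval (map \<tau> q) b) = H (b [^] length q \<oplus> eval q b)"
        using Hadd[OF Bpow[OF b] evB[OF q(1)]] Hadd[OF Bpow[OF b] evB[of "map \<tau> q"]] Hev[OF q(1)]
          qA' A'(2) by auto
      then show ?thesis using ev[OF bc] q(2) H0 by simp
    qed
    \<comment> \<open>As \<open>D\<close> is a domain, a vanishing product has a vanishing factor,
      and the empty product is excluded because one is nonzero in \<open>D\<close>.\<close>
    moreover have "(\<exists>c\<in>set l. H c = H b)" if "H (foldr (\<lambda>c y. (b \<ominus> c) \<otimes> y) l \<one>) = \<zero>\<^bsub>D\<^esub>" "set l \<subseteq> B'" for l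
      using that
    proof (induction l)
      case Nil
      then show ?case using H1 by simp
    next
      case (Cons c l)
      have cB: "c \<in> B" "\<ominus> c \<in> B" using Cons.prems B'B subringE(5)[OF B] by auto
      have bc: "b \<oplus> \<ominus> c \<in> B" using subringE(7)[OF B] b cB by blast
      let ?f = "foldr (\<lambda>c y. (b \<ominus> c) \<otimes> y) l \<one>"
      have "set l \<subseteq> B" using Cons.prems B'B by auto
      then have f: "?f \<in> B"
        by (induction l) (use b subringE(3,5,6,7)[OF B] in \<open>auto simp: minus_eq\<close>)
      have "H (b \<oplus> \<ominus> c) \<otimes>\<^bsub>D\<^esub> H ?f = \<zero>\<^bsub>D\<^esub>"
        using Cons.prems(1) Hmult[OF bc f] by (simp add: minus_eq)
      then have "H (b \<oplus> \<ominus> c) = \<zero>\<^bsub>D\<^esub> \<or> H ?f = \<zero>\<^bsub>D\<^esub>" using D.integral Hc bc f by blast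
      then show ?case
      proof
        assume "H (b \<oplus> \<ominus> c) = \<zero>\<^bsub>D\<^esub>"
        then have "H b \<oplus>\<^bsub>D\<^esub> \<ominus>\<^bsub>D\<^esub> H c = \<zero>\<^bsub>D\<^esub>" using Hadd[OF b cB(2)] Hinv[OF cB(1)] by simp
        then have "H b = H c" using Hc b cB(1) by (metis D.minus_eq D.r_right_minus_eq)
        then show ?thesis by simp
      qed (use Cons in auto)
    qed
    ultimately obtain c where "c \<in> set cs" "H c = H b" using csB' by blast
    then show ?thesis using csB' by blast
  qed
  define \<pi> where "\<pi> b = (THE c. c \<in> B' \<and> H c = H b)" for b
  have \<pi>: "\<pi> b \<in> B'" "H (\<pi> b) = H b" if "b \<in> B" for b
  proof -
    have "\<exists>!c. c \<in> B' \<and> H c = H b" using exists[OF that] unique by metis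
    from theI'[OF this] show "\<pi> b \<in> B'" "H (\<pi> b) = H b" unfolding \<pi>_def by auto
  qed
  have \<pi>I: "\<pi> b = c" if "b \<in> B" "c \<in> B'" "H c = H b" for b c
    using unique[OF \<pi>(1)[OF that(1)] that(2)] \<pi>(2)[OF that(1)] that(3) by simp
  show thesis
  proof (rule that[of \<pi>])
    show "\<pi> \<in> B \<rightarrow> B'" using \<pi> by blast
    show "\<pi> b = b" if "b \<in> B'" for b using \<pi>I[OF B'B[OF that] that] by simp
    show "\<pi> a \<in> A'" if "a \<in> A" for a
      using \<pi>I[OF AB[OF that] AB'[OF \<tau>A(1)[OF that]]] H\<tau>[OF that] \<tau>A[OF that] by simp
    show "\<pi> (a \<oplus> b) = \<pi> a \<oplus> \<pi> b" if "a \<in> B" "b \<in> B" for a b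
      by (rule \<pi>I) (use that \<pi> subringE(7)[OF B] subringE(7)[OF B'] Hadd B'B in auto)
    show "\<pi> (a \<otimes> b) = \<pi> a \<otimes> \<pi> b" if "a \<in> B" "b \<in> B" for a b
      by (rule \<pi>I) (use that \<pi> subringE(6)[OF B] subringE(6)[OF B'] Hmult B'B in auto)
  qed
qed

section \<open>Quotient modules and direct summands\<close>

lemma (in module) submodule_abelian_subgroup: "submodule N R M \<Longrightarrow> abelian_subgroup N M"
  using abelian_subgroupI3[OF additive_subgroupI] submodule.axioms(1) abelian_group_axioms by blast

context module
begin

lemma coset_cases:
  assumes "C \<in> carrier (quotient_module M N)"
  obtains x where "x \<in> carrier M" "C = N +>\<^bsub>M\<^esub> x"
  using assms unfolding quotient_module_def A_RCOSETS_def' by auto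

lemma coset_closed: "x \<in> carrier M \<Longrightarrow> N +>\<^bsub>M\<^esub> x \<in> carrier (quotient_module M N)"
  unfolding quotient_module_def A_RCOSETS_def' by auto

context
  fixes N assumes N: "submodule N R M"
begin

interpretation N: abelian_subgroup N M by (rule submodule_abelian_subgroup[OF N])

lemma coset_eq_iff:
  assumes "x \<in> carrier M" "y \<in> carrier M"
  shows "N +>\<^bsub>M\<^esub> x = N +>\<^bsub>M\<^esub> y \<longleftrightarrow> x \<ominus>\<^bsub>M\<^esub> y \<in> N"
proof
  assume "N +>\<^bsub>M\<^esub> x = N +>\<^bsub>M\<^esub> y"
  then have "x \<in> N +>\<^bsub>M\<^esub> y" using N.a_rcos_self[OF assms(1)] by simp
  then show "x \<ominus>\<^bsub>M\<^esub> y \<in> N" using assms by (metis N.a_rcos_module M.minus_eq)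
next
  assume "x \<ominus>\<^bsub>M\<^esub> y \<in> N"
  then have "x \<in> N +>\<^bsub>M\<^esub> y" using assms by (metis N.a_rcos_module M.minus_eq)
  then show "N +>\<^bsub>M\<^esub> x = N +>\<^bsub>M\<^esub> y" using N.a_repr_independence' assms by metis
qed

lemma coset_add:
  assumes "x \<in> carrier M" "y \<in> carrier M"
  shows "(N +>\<^bsub>M\<^esub> x) \<oplus>\<^bsub>quotient_module M N\<^esub> (N +>\<^bsub>M\<^esub> y) = N +>\<^bsub>M\<^esub> (x \<oplus>\<^bsub>M\<^esub> y)"
  unfolding quotient_module_def using N.a_rcos_sum[OF assms] by simp

text \<open>Two representatives differ by an element of \<open>N\<close>, and \<open>N\<close> is
  stable under scalars. The union in the definition of the scalar action therefore runs over a
  single coset.\<close>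

lemma coset_smult:
  assumes "a \<in> carrier R" "x \<in> carrier M"
  shows "a \<odot>\<^bsub>quotient_module M N\<^esub> (N +>\<^bsub>M\<^esub> x) = N +>\<^bsub>M\<^esub> (a \<odot>\<^bsub>M\<^esub> x)"
proof -
  have eq: "N +>\<^bsub>M\<^esub> (a \<odot>\<^bsub>M\<^esub> y) = N +>\<^bsub>M\<^esub> (a \<odot>\<^bsub>M\<^esub> x)" if y: "y \<in> N +>\<^bsub>M\<^esub> x" for y
  proof -
    have yc: "y \<in> carrier M" using y assms N.a_elemrcos_carrier by blast
    have "y \<ominus>\<^bsub>M\<^esub> x \<in> N" using y yc assms by (metis N.a_rcos_module M.minus_eq)
    then have "a \<odot>\<^bsub>M\<^esub> (y \<ominus>\<^bsub>M\<^esub> x) \<in> N" using submodule.smult_closed[OF N] assms by blast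
    then have "a \<odot>\<^bsub>M\<^esub> y \<ominus>\<^bsub>M\<^esub> a \<odot>\<^bsub>M\<^esub> x \<in> N"
      using yc assms by (simp add: M.minus_eq smult_r_distr smult_r_minus)
    then show ?thesis using coset_eq_iff yc assms by simp
  qed
  have self: "x \<in> N +>\<^bsub>M\<^esub> x" using N.a_rcos_self[OF assms(2)] .
  have "(\<Union>y\<in>N +>\<^bsub>M\<^esub> x. N +>\<^bsub>M\<^esub> (a \<odot>\<^bsub>M\<^esub> y)) = N +>\<^bsub>M\<^esub> (a \<odot>\<^bsub>M\<^esub> x)"
    by (rule SUP_eq_const) (use self eq in \<open>metis empty_iff\<close>)+
  then show ?thesis unfolding quotient_module_def by (simp only: module.simps)
qed

lemma coset_zero: "\<zero>\<^bsub>quotient_module M N\<^esub> = N +>\<^bsub>M\<^esub> \<zero>\<^bsub>M\<^esub>"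
  unfolding quotient_module_def using M.a_coset_add_zero[OF N.a_subset] by simp

text \<open>\<open>submodule\<close> speaks of inverses in the additive monoid of the quotient; the
  group structure makes them unique, so that \<open>coset_inv\<close> can compute them.\<close>

lemma quotient_add_group: "group (add_monoid (quotient_module M N))"
proof (rule groupI)
  fix C D E
  assume C: "C \<in> carrier (add_monoid (quotient_module M N))"
    and D: "D \<in> carrier (add_monoid (quotient_module M N))"
    and E: "E \<in> carrier (add_monoid (quotient_module M N))"
  obtain x where x: "x \<in> carrier M" "C = N +>\<^bsub>M\<^esub> x" using C coset_cases by auto
  obtain y where y: "y \<in> carrier M" "D = N +>\<^bsub>M\<^esub> y" using D coset_cases by auto
  obtain z where z: "z \<in> carrier M" "E = N +>\<^bsub>M\<^esub> z" using E coset_cases by auto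
  show "C \<otimes>\<^bsub>add_monoid (quotient_module M N)\<^esub> D \<in> carrier (add_monoid (quotient_module M N))"
    using x y coset_add coset_closed by simp
  show "C \<otimes>\<^bsub>add_monoid (quotient_module M N)\<^esub> D \<otimes>\<^bsub>add_monoid (quotient_module M N)\<^esub> E =
    C \<otimes>\<^bsub>add_monoid (quotient_module M N)\<^esub> (D \<otimes>\<^bsub>add_monoid (quotient_module M N)\<^esub> E)"
    using x y z coset_add by (simp add: M.a_assoc)
next
  fix C assume C: "C \<in> carrier (add_monoid (quotient_module M N))"
  obtain x where x: "x \<in> carrier M" "C = N +>\<^bsub>M\<^esub> x" using C coset_cases by auto
  show "\<one>\<^bsub>add_monoid (quotient_module M N)\<^esub> \<otimes>\<^bsub>add_monoid (quotient_module M N)\<^esub> C = C"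
    using x coset_zero coset_add by simp
  have "(N +>\<^bsub>M\<^esub> (\<ominus>\<^bsub>M\<^esub> x)) \<otimes>\<^bsub>add_monoid (quotient_module M N)\<^esub> C = \<one>\<^bsub>add_monoid (quotient_module M N)\<^esub>"
    using x coset_add coset_zero by (simp add: M.l_neg)
  moreover have "N +>\<^bsub>M\<^esub> (\<ominus>\<^bsub>M\<^esub> x) \<in> carrier (add_monoid (quotient_module M N))"
    using x coset_closed by simp
  ultimately show "\<exists>D\<in>carrier (add_monoid (quotient_module M N)).
    D \<otimes>\<^bsub>add_monoid (quotient_module M N)\<^esub> C = \<one>\<^bsub>add_monoid (quotient_module M N)\<^esub>" by blast
qed (use coset_zero coset_closed in simp)

lemma coset_inv:
  assumes "x \<in> carrier M"
  shows "inv\<^bsub>add_monoid (quotient_module M N)\<^esub> (N +>\<^bsub>M\<^esub> x) = N +>\<^bsub>M\<^esub> (\<ominus>\<^bsub>M\<^esub> x)"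
proof (rule group.inv_equality[OF quotient_add_group])
  show "(N +>\<^bsub>M\<^esub> (\<ominus>\<^bsub>M\<^esub> x)) \<otimes>\<^bsub>add_monoid (quotient_module M N)\<^esub> (N +>\<^bsub>M\<^esub> x) = \<one>\<^bsub>add_monoid (quotient_module M N)\<^esub>"
    using coset_add[of "\<ominus>\<^bsub>M\<^esub> x" x] coset_zero assms by (simp add: M.l_neg)
qed (use assms coset_closed in simp_all)

lemma submodule_quotientI:
  assumes "Y \<subseteq> carrier M" "\<zero>\<^bsub>M\<^esub> \<in> Y"
    and "\<And>x. x \<in> Y \<Longrightarrow> \<ominus>\<^bsub>M\<^esub> x \<in> Y" "\<And>x y. x \<in> Y \<Longrightarrow> y \<in> Y \<Longrightarrow> x \<oplus>\<^bsub>M\<^esub> y \<in> Y"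
    and "\<And>a x. a \<in> carrier R \<Longrightarrow> x \<in> Y \<Longrightarrow> a \<odot>\<^bsub>M\<^esub> x \<in> Y"
  shows "submodule ((\<lambda>x. N +>\<^bsub>M\<^esub> x) ` Y) R (quotient_module M N)"
proof (intro submodule.intro subgroup.intro submodule_axioms.intro)
  fix C D assume "C \<in> (\<lambda>x. N +>\<^bsub>M\<^esub> x) ` Y" "D \<in> (\<lambda>x. N +>\<^bsub>M\<^esub> x) ` Y"
  then show "C \<otimes>\<^bsub>add_monoid (quotient_module M N)\<^esub> D \<in> (\<lambda>x. N +>\<^bsub>M\<^esub> x) ` Y"
    using coset_add assms(1,4) by (auto simp: subset_iff)
next
  fix C assume "C \<in> (\<lambda>x. N +>\<^bsub>M\<^esub> x) ` Y"
  then show "inv\<^bsub>add_monoid (quotient_module M N)\<^esub> C \<in> (\<lambda>x. N +>\<^bsub>M\<^esub> x) ` Y"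
    using coset_inv assms(1,3) by (auto simp: subset_iff)
next
  fix a C assume "a \<in> carrier R" "C \<in> (\<lambda>x. N +>\<^bsub>M\<^esub> x) ` Y"
  then show "a \<odot>\<^bsub>quotient_module M N\<^esub> C \<in> (\<lambda>x. N +>\<^bsub>M\<^esub> x) ` Y"
    using coset_smult assms(1,5) by (auto simp: subset_iff)
qed (use assms(1,2) coset_closed coset_zero in auto)

end

text \<open>By \<open>iN\<close> and \<open>rN\<close> both maps descend to the quotients, and the
  composite remains the identity. The complement is the kernel of the induced retraction, realised
  as the image of the elements that \<open>r\<close> sends into \<open>N'\<close>.\<close>

lemma quotient_retract_direct_summand:
  fixes M' :: "('a, 'c, 'e) module_scheme"
  assumes M': "module R M'" and N: "submodule N R M" and N': "submodule N' R M'"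
    and i: "linear_map R M' M i" and r: "linear_map R M M' r"
    and ri: "\<And>x. x \<in> carrier M' \<Longrightarrow> r (i x) = x"
    and iN: "\<And>x. x \<in> N' \<Longrightarrow> i x \<in> N" and rN: "\<And>x. x \<in> N \<Longrightarrow> r x \<in> N'"
  obtains h where "linear_map R (quotient_module M' N') (quotient_module M N) h"
    "\<And>x. x \<in> carrier M' \<Longrightarrow> h (N' +>\<^bsub>M'\<^esub> x) = N +>\<^bsub>M\<^esub> (i x)"
    "inj_on h (carrier (quotient_module M' N'))"
    "direct_summand (h ` carrier (quotient_module M' N')) R (quotient_module M N)"
proof -
  interpret M': module R M' by (rule M')
  let ?Q = "quotient_module M N" and ?Q' = "quotient_module M' N'"
  have i_add: "i (x \<oplus>\<^bsub>M'\<^esub> y) = i x \<oplus>\<^bsub>M\<^esub> i y"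
    if "x \<in> carrier M'" "y \<in> carrier M'" for x y
    using i that unfolding linear_map_def by auto
  have i_smult: "i (a \<odot>\<^bsub>M'\<^esub> x) = a \<odot>\<^bsub>M\<^esub> i x"
    if "a \<in> carrier R" "x \<in> carrier M'" for a x
    using i that unfolding linear_map_def by auto
  have r_add: "r (x \<oplus>\<^bsub>M\<^esub> y) = r x \<oplus>\<^bsub>M'\<^esub> r y"
    if "x \<in> carrier M" "y \<in> carrier M" for x y
    using r that unfolding linear_map_def by auto
  have r_smult: "r (a \<odot>\<^bsub>M\<^esub> x) = a \<odot>\<^bsub>M'\<^esub> r x"
    if "a \<in> carrier R" "x \<in> carrier M" for a x
    using r that unfolding linear_map_def by auto
  have i_c: "i x \<in> carrier M" if "x \<in> carrier M'" for x using i that unfolding linear_map_def by auto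
  have r_c: "r x \<in> carrier M'" if "x \<in> carrier M" for x using r that unfolding linear_map_def by auto
  have i_inv: "i (\<ominus>\<^bsub>M'\<^esub> x) = \<ominus>\<^bsub>M\<^esub> i x" if "x \<in> carrier M'" for x
    using i_smult[of "\<ominus> \<one>" x] that i_c by (simp add: smult_l_minus M'.smult_l_minus)
  have r_inv: "r (\<ominus>\<^bsub>M\<^esub> x) = \<ominus>\<^bsub>M'\<^esub> r x" if "x \<in> carrier M" for x
    using r_smult[of "\<ominus> \<one>" x] that r_c by (simp add: smult_l_minus M'.smult_l_minus)
  have i_minus: "i (x \<ominus>\<^bsub>M'\<^esub> y) = i x \<ominus>\<^bsub>M\<^esub> i y" if "x \<in> carrier M'" "y \<in> carrier M'" for x y
    using i_add i_inv that by (simp add: M.minus_eq M'.M.minus_eq)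
  have r_minus: "r (x \<ominus>\<^bsub>M\<^esub> y) = r x \<ominus>\<^bsub>M'\<^esub> r y" if "x \<in> carrier M" "y \<in> carrier M" for x y
    using r_add r_inv that by (simp add: M.minus_eq M'.M.minus_eq)
  have Nc: "x \<in> carrier M" if "x \<in> N" for x using submoduleE(1)[OF N] that by blast
  have Nc': "x \<in> carrier M'" if "x \<in> N'" for x using M'.submoduleE(1)[OF N'] that by blast
  \<comment> \<open>Taking a union over the coset avoids choosing a representative;
    \<open>iN\<close> makes all its members equal.\<close>
  define h where "h C = (\<Union>x\<in>C. N +>\<^bsub>M\<^esub> (i x))" for C
  have h: "h (N' +>\<^bsub>M'\<^esub> x) = N +>\<^bsub>M\<^esub> (i x)" if x: "x \<in> carrier M'" for x
  proof -
    have eq: "N +>\<^bsub>M\<^esub> (i y) = N +>\<^bsub>M\<^esub> (i x)" if y: "y \<in> N' +>\<^bsub>M'\<^esub> x" for y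
    proof -
      interpret N': abelian_subgroup N' M' by (rule M'.submodule_abelian_subgroup[OF N'])
      have yc: "y \<in> carrier M'" using y x N'.a_elemrcos_carrier by blast
      have "N' +>\<^bsub>M'\<^esub> y = N' +>\<^bsub>M'\<^esub> x" using N'.a_repr_independence'[OF y x] ..
      then have "y \<ominus>\<^bsub>M'\<^esub> x \<in> N'" using M'.coset_eq_iff[OF N' yc x] by simp
      then show ?thesis using iN[of "y \<ominus>\<^bsub>M'\<^esub> x"] i_minus[OF yc x] coset_eq_iff[OF N i_c[OF yc] i_c[OF x]] by simp
    qed
    have self: "x \<in> N' +>\<^bsub>M'\<^esub> x"
      using abelian_subgroup.a_rcos_self[OF M'.submodule_abelian_subgroup[OF N'] x] .
    show ?thesis unfolding h_def
      by (rule SUP_eq_const) (use self eq in \<open>metis empty_iff\<close>)+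
  qed
  have "linear_map R ?Q' ?Q h"
    unfolding linear_map_def
  proof (intro conjI ballI)
    show "h \<in> carrier ?Q' \<rightarrow> carrier ?Q"
    proof
      fix C assume "C \<in> carrier ?Q'"
      then obtain x where "x \<in> carrier M'" "C = N' +>\<^bsub>M'\<^esub> x" by (rule M'.coset_cases)
      then show "h C \<in> carrier ?Q" using h i_c coset_closed by simp
    qed
    fix C assume "C \<in> carrier ?Q'"
    then obtain x where x: "x \<in> carrier M'" "C = N' +>\<^bsub>M'\<^esub> x" by (rule M'.coset_cases)
    show "h (C \<oplus>\<^bsub>?Q'\<^esub> D) = h C \<oplus>\<^bsub>?Q\<^esub> h D" if D: "D \<in> carrier ?Q'" for D
    proof -
      obtain y where y: "y \<in> carrier M'" "D = N' +>\<^bsub>M'\<^esub> y" using D by (rule M'.coset_cases)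
      show ?thesis
        unfolding x(2) y(2) M'.coset_add[OF N' x(1) y(1)] h[OF x(1)] h[OF y(1)] h[OF M'.M.a_closed[OF x(1) y(1)]]
          coset_add[OF N i_c[OF x(1)] i_c[OF y(1)]] i_add[OF x(1) y(1)] ..
    qed
    show "h (a \<odot>\<^bsub>?Q'\<^esub> C) = a \<odot>\<^bsub>?Q\<^esub> h C" if "a \<in> carrier R" for a
      unfolding x(2) M'.coset_smult[OF N' that x(1)] h[OF x(1)] h[OF M'.smult_closed[OF that x(1)]]
        coset_smult[OF N that i_c[OF x(1)]] i_smult[OF that x(1)] ..
  qed
  moreover have "inj_on h (carrier ?Q')"
  proof (rule inj_onI)
    fix C D assume CD: "C \<in> carrier ?Q'" "D \<in> carrier ?Q'" "h C = h D"
    obtain x where x: "x \<in> carrier M'" "C = N' +>\<^bsub>M'\<^esub> x" using CD(1) by (rule M'.coset_cases)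
    obtain y where y: "y \<in> carrier M'" "D = N' +>\<^bsub>M'\<^esub> y" using CD(2) by (rule M'.coset_cases)
    have "i (x \<ominus>\<^bsub>M'\<^esub> y) \<in> N"
      using CD(3) h x y coset_eq_iff[OF N] i_c i_minus by simp
    then have "r (i (x \<ominus>\<^bsub>M'\<^esub> y)) \<in> N'" by (rule rN)
    then have "x \<ominus>\<^bsub>M'\<^esub> y \<in> N'" using ri x y by simp
    then show "C = D" using M'.coset_eq_iff[OF N'] x y by simp
  qed
  moreover have "direct_summand (h ` carrier ?Q') R ?Q"
  proof -
    have im: "h ` carrier ?Q' = (\<lambda>x. N +>\<^bsub>M\<^esub> x) ` (i ` carrier M')"
    proof (intro equalityI subsetI)
      fix D assume "D \<in> h ` carrier ?Q'"
      then obtain C where C: "C \<in> carrier ?Q'" "D = h C" by blast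
      obtain x where "x \<in> carrier M'" "C = N' +>\<^bsub>M'\<^esub> x" using C(1) by (rule M'.coset_cases)
      then show "D \<in> (\<lambda>x. N +>\<^bsub>M\<^esub> x) ` (i ` carrier M')" using C(2) h by simp
    next
      fix D assume "D \<in> (\<lambda>x. N +>\<^bsub>M\<^esub> x) ` (i ` carrier M')"
      then obtain x where "x \<in> carrier M'" "D = N +>\<^bsub>M\<^esub> (i x)" by blast
      then show "D \<in> h ` carrier ?Q'" using h M'.coset_closed by (metis imageI)
    qed
    let ?Y = "{x \<in> carrier M. r x \<in> N'}"
    let ?P = "(\<lambda>x. N +>\<^bsub>M\<^esub> x) ` ?Y"
    have r0: "r \<zero>\<^bsub>M\<^esub> = \<zero>\<^bsub>M'\<^esub>"
      using r_smult[OF R.zero_closed M.zero_closed] r_c[OF M.zero_closed] by simp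
    have i0: "i \<zero>\<^bsub>M'\<^esub> = \<zero>\<^bsub>M\<^esub>"
      using i_smult[OF R.zero_closed M'.M.zero_closed] i_c[OF M'.M.zero_closed] by simp
    have 1: "submodule ((\<lambda>x. N +>\<^bsub>M\<^esub> x) ` (i ` carrier M')) R ?Q"
    proof (rule submodule_quotientI[OF N])
      show "\<zero>\<^bsub>M\<^esub> \<in> i ` carrier M'" using i0 by (metis M'.M.zero_closed imageI)
      show "\<ominus>\<^bsub>M\<^esub> x \<in> i ` carrier M'" if "x \<in> i ` carrier M'" for x
        using that i_inv by (metis (no_types, lifting) M'.M.a_inv_closed image_iff)
      show "x \<oplus>\<^bsub>M\<^esub> y \<in> i ` carrier M'" if "x \<in> i ` carrier M'" "y \<in> i ` carrier M'" for x y
        using that i_add by (metis (no_types, lifting) M'.M.a_closed image_iff)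
      show "a \<odot>\<^bsub>M\<^esub> x \<in> i ` carrier M'" if "a \<in> carrier R" "x \<in> i ` carrier M'" for a x
        using that i_smult by (metis (no_types, lifting) M'.smult_closed image_iff)
      show "i ` carrier M' \<subseteq> carrier M" using i_c by blast
    qed
    have 2: "submodule ?P R ?Q"
    proof (rule submodule_quotientI[OF N])
      show "\<zero>\<^bsub>M\<^esub> \<in> ?Y" using r0 M'.submoduleE(2)[OF N'] 
        subgroup.one_closed[OF submodule.axioms(1)[OF N']] by simp
      show "\<ominus>\<^bsub>M\<^esub> x \<in> ?Y" if "x \<in> ?Y" for x
        using that r_inv M'.submoduleE(3)[OF N'] by simp
      show "x \<oplus>\<^bsub>M\<^esub> y \<in> ?Y" if "x \<in> ?Y" "y \<in> ?Y" for x y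
        using that r_add M'.submoduleE(5)[OF N'] by simp
      show "a \<odot>\<^bsub>M\<^esub> x \<in> ?Y" if "a \<in> carrier R" "x \<in> ?Y" for a x
        using that r_smult M'.submoduleE(4)[OF N'] by simp
    qed blast
    have zero: "\<zero>\<^bsub>?Q\<^esub> \<in> ?P" "\<zero>\<^bsub>?Q\<^esub> \<in> h ` carrier ?Q'"
      using subgroup.one_closed[OF submodule.axioms(1)[OF 2]]
        subgroup.one_closed[OF submodule.axioms(1)[OF 1]] im by simp_all
    have int: "C = \<zero>\<^bsub>?Q\<^esub>" if C: "C \<in> h ` carrier ?Q'" "C \<in> ?P" for C
    proof -
      obtain y where y: "y \<in> carrier M'" "C = N +>\<^bsub>M\<^esub> (i y)" using C(1) unfolding im by blast
      obtain x where x: "x \<in> carrier M" "r x \<in> N'" "C = N +>\<^bsub>M\<^esub> x" using C(2) by blast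
      have "i y \<ominus>\<^bsub>M\<^esub> x \<in> N" using coset_eq_iff[OF N i_c[OF y(1)] x(1)] y(2) x(3) by simp
      then have "r (i y \<ominus>\<^bsub>M\<^esub> x) \<in> N'" by (rule rN)
      then have d: "y \<ominus>\<^bsub>M'\<^esub> r x \<in> N'" using r_minus[OF i_c[OF y(1)] x(1)] ri[OF y(1)] by simp
      have "y = (y \<ominus>\<^bsub>M'\<^esub> r x) \<oplus>\<^bsub>M'\<^esub> r x"
        using y(1) r_c[OF x(1)] by (simp add: M'.M.minus_eq M'.M.a_assoc M'.M.l_neg)
      then have "y \<in> N'" using M'.submoduleE(5)[OF N' d x(2)] by simp
      then have "i y \<in> N" by (rule iN)
      moreover have "i y \<ominus>\<^bsub>M\<^esub> \<zero>\<^bsub>M\<^esub> = i y"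
        using i_c[OF y(1)] by (metis M.a_inv_closed M.l_zero M.minus_eq M.r_neg M.r_zero M.zero_closed)
      ultimately have "i y \<ominus>\<^bsub>M\<^esub> \<zero>\<^bsub>M\<^esub> \<in> N" by simp
      then show ?thesis using coset_eq_iff[OF N i_c[OF y(1)] M.zero_closed] y(2) coset_zero[OF N] by simp
    qed
    have sum: "set_add ?Q (h ` carrier ?Q') ?P = carrier ?Q"
    proof
      show "set_add ?Q (h ` carrier ?Q') ?P \<subseteq> carrier ?Q"
        unfolding set_add_def' im using coset_add[OF N] coset_closed i_c by auto
      show "carrier ?Q \<subseteq> set_add ?Q (h ` carrier ?Q') ?P"
      proof
        fix C assume "C \<in> carrier ?Q"
        then obtain x where x: "x \<in> carrier M" "C = N +>\<^bsub>M\<^esub> x" by (rule coset_cases)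
        \<comment> \<open>The usual projection: \<open>x\<close> is \<open>i (r x)\<close> plus a
          remainder that \<open>r\<close> kills.\<close>
        let ?y = "i (r x)"
        have y: "?y \<in> carrier M" using x r_c i_c by simp
        have "r (x \<ominus>\<^bsub>M\<^esub> ?y) = \<zero>\<^bsub>M'\<^esub>"
          using r_minus[OF x(1) y] ri[OF r_c[OF x(1)]] r_c[OF x(1)] by (simp add: M'.M.minus_eq M'.M.r_neg)
        then have "x \<ominus>\<^bsub>M\<^esub> ?y \<in> ?Y" using x y subgroup.one_closed[OF submodule.axioms(1)[OF N']] by simp
        moreover have "N +>\<^bsub>M\<^esub> ?y \<in> h ` carrier ?Q'" unfolding im using x r_c by blast
        moreover have "C = (N +>\<^bsub>M\<^esub> ?y) \<oplus>\<^bsub>?Q\<^esub> (N +>\<^bsub>M\<^esub> (x \<ominus>\<^bsub>M\<^esub> ?y))"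
        proof -
          have "?y \<oplus>\<^bsub>M\<^esub> (x \<ominus>\<^bsub>M\<^esub> ?y) = x"
            using x(1) y by (simp add: M.minus_eq M.a_lcomm M.r_neg)
          then show ?thesis using coset_add[OF N y, of "x \<ominus>\<^bsub>M\<^esub> ?y"] x y by simp
        qed
        ultimately show "C \<in> set_add ?Q (h ` carrier ?Q') ?P" unfolding set_add_def' by blast
      qed
    qed
    have "h ` carrier ?Q' \<inter> ?P = {\<zero>\<^bsub>?Q\<^esub>}"
    proof (intro equalityI subsetI)
      fix C assume "C \<in> h ` carrier ?Q' \<inter> ?P"
      then have "C = \<zero>\<^bsub>?Q\<^esub>" by (intro int) (rule IntD1 IntD2, assumption)+
      then show "C \<in> {\<zero>\<^bsub>?Q\<^esub>}" by (simp only: singletonI)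
    next
      fix C assume "C \<in> {\<zero>\<^bsub>?Q\<^esub>}"
      then have "C = \<zero>\<^bsub>?Q\<^esub>" by (rule singletonD)
      then show "C \<in> h ` carrier ?Q' \<inter> ?P" using zero by (metis IntI)
    qed
    then show ?thesis
      unfolding direct_summand_def
      by (intro conjI exI[of _ ?P] 1[folded im] 2 sum)
  qed
  ultimately show thesis using that[of h] h by simp
qed

end

section \<open>Restriction of scalars, generated submodules and free modules\<close>

text \<open>The differentials of the large ring are a module over that ring, while linearity and
  direct summands are later required over the subring.\<close>

lemma (in module) restrict_scalars:
  assumes C: "subring C R"
  shows "module (R\<lparr>carrier := C\<rparr>) M"
proof (rule moduleI)
  show "cring (R\<lparr>carrier := C\<rparr>)"
    using R.subcring_iff[OF subringE(1)[OF C]] R.subcringI'[OF C] by simp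
  have "c \<in> carrier R" if "c \<in> C" for c using subringE(1)[OF C] that by blast
  then show "a \<odot>\<^bsub>M\<^esub> x \<in> carrier M" 
    "(a \<oplus>\<^bsub>R\<lparr>carrier := C\<rparr>\<^esub> b) \<odot>\<^bsub>M\<^esub> x = a \<odot>\<^bsub>M\<^esub> x \<oplus>\<^bsub>M\<^esub> b \<odot>\<^bsub>M\<^esub> x"
    "a \<odot>\<^bsub>M\<^esub> (x \<oplus>\<^bsub>M\<^esub> y) = a \<odot>\<^bsub>M\<^esub> x \<oplus>\<^bsub>M\<^esub> a \<odot>\<^bsub>M\<^esub> y"
    "(a \<otimes>\<^bsub>R\<lparr>carrier := C\<rparr>\<^esub> b) \<odot>\<^bsub>M\<^esub> x = a \<odot>\<^bsub>M\<^esub> (b \<odot>\<^bsub>M\<^esub> x)"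
    if "a \<in> carrier (R\<lparr>carrier := C\<rparr>)" "b \<in> carrier (R\<lparr>carrier := C\<rparr>)" "x \<in> carrier M" "y \<in> carrier M"
    for a b x y
    using that by (simp_all add: smult_l_distr smult_r_distr smult_assoc1)
  show "\<one>\<^bsub>R\<lparr>carrier := C\<rparr>\<^esub> \<odot>\<^bsub>M\<^esub> x = x" if "x \<in> carrier M" for x using that by simp
qed (rule M.abelian_group_axioms)

lemma (in module) submodule_restrict_scalars:
  assumes "C \<subseteq> carrier R" "submodule N R M"
  shows "submodule N (R\<lparr>carrier := C\<rparr>) M"
  using assms submodule.axioms[OF assms(2)]
  by (intro submodule.intro submodule_axioms.intro) (auto simp: submodule_axioms_def)

context module
begin

lemma generated_submodule_incl: "G \<subseteq> generated_submodule R M G"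
  unfolding generated_submodule_def by blast

lemma generated_submodule_least: "submodule N R M \<Longrightarrow> G \<subseteq> N \<Longrightarrow> generated_submodule R M G \<subseteq> N"
  unfolding generated_submodule_def by blast

lemma generated_submodule_is_submodule:
  assumes "G \<subseteq> carrier M"
  shows "submodule (generated_submodule R M G) R M"
proof -
  have mem: "x \<in> generated_submodule R M G \<longleftrightarrow> (\<forall>N. submodule N R M \<longrightarrow> G \<subseteq> N \<longrightarrow> x \<in> N)" for x
    unfolding generated_submodule_def by blast
  show ?thesis
  proof (rule submoduleI)
    show "generated_submodule R M G \<subseteq> carrier M"
      by (rule generated_submodule_least[OF carrier_is_submodule assms])
    show "\<zero>\<^bsub>M\<^esub> \<in> generated_submodule R M G"
      unfolding mem using subgroup.one_closed[OF submodule.axioms(1)] by fastforce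
    show "\<ominus>\<^bsub>M\<^esub> a \<in> generated_submodule R M G" if "a \<in> generated_submodule R M G" for a
      using that unfolding mem using submoduleE(3) by blast
    show "a \<oplus>\<^bsub>M\<^esub> b \<in> generated_submodule R M G"
      if "a \<in> generated_submodule R M G" "b \<in> generated_submodule R M G" for a b
      using that unfolding mem using submoduleE(5) by blast
    show "a \<odot>\<^bsub>M\<^esub> x \<in> generated_submodule R M G"
      if "a \<in> carrier R" "x \<in> generated_submodule R M G" for a x
      using that unfolding mem using submoduleE(4) by blast
  qed
qed

end

context cring
begin

lemma free_module_carrierD:
  assumes "f \<in> carrier (free_module R S)"
  shows "f x \<in> carrier R" "x \<notin> S \<Longrightarrow> f x = \<zero>" "finite {x. f x \<noteq> \<zero>}"
  using assms unfolding free_module_def by auto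

lemma free_module_is_module: "module R (free_module R S)"
proof (rule moduleI)
  show "abelian_group (free_module R S)"
  proof (rule abelian_groupI)
    show "f \<oplus>\<^bsub>free_module R S\<^esub> g \<in> carrier (free_module R S)"
      if "f \<in> carrier (free_module R S)" "g \<in> carrier (free_module R S)" for f g
    proof -
      have "{x. f x \<oplus> g x \<noteq> \<zero>} \<subseteq> {x. f x \<noteq> \<zero>} \<union> {x. g x \<noteq> \<zero>}" by auto
      then have "finite {x. f x \<oplus> g x \<noteq> \<zero>}"
        using free_module_carrierD(3)[OF that(1)] free_module_carrierD(3)[OF that(2)]
        by (meson finite_UnI finite_subset)
      then show ?thesis using that unfolding free_module_def by simp
    qed
    show "\<exists>g\<in>carrier (free_module R S). g \<oplus>\<^bsub>free_module R S\<^esub> f = \<zero>\<^bsub>free_module R S\<^esub>"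
      if "f \<in> carrier (free_module R S)" for f
    proof
      have "\<ominus> f x \<noteq> \<zero> \<longleftrightarrow> f x \<noteq> \<zero>" for x
        using free_module_carrierD(1)[OF that, of x] by (metis a_inv_closed l_zero minus_equality minus_minus zero_closed)
      then show "(\<lambda>x. \<ominus> f x) \<in> carrier (free_module R S)" using that unfolding free_module_def by simp
      show "(\<lambda>x. \<ominus> f x) \<oplus>\<^bsub>free_module R S\<^esub> f = \<zero>\<^bsub>free_module R S\<^esub>"
        using that unfolding free_module_def by (simp add: l_neg)
    qed
  qed (auto simp: free_module_def a_ac)
  show "a \<odot>\<^bsub>free_module R S\<^esub> f \<in> carrier (free_module R S)"
    if "a \<in> carrier R" "f \<in> carrier (free_module R S)" for a f
  proof -
    have "{x. a \<otimes> f x \<noteq> \<zero>} \<subseteq> {x. f x \<noteq> \<zero>}" using that by auto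
    then have "finite {x. a \<otimes> f x \<noteq> \<zero>}"
      using free_module_carrierD(3)[OF that(2)] finite_subset by blast
    then show ?thesis using that unfolding free_module_def by simp
  qed
qed (auto simp: free_module_def l_distr r_distr m_assoc is_cring)

text \<open>Negation in a record is determined through its carrier, so the free modules over a ring
  and over a subring might a priori negate differently. The pointwise formula reconciles the
  two.\<close>

lemma free_module_uminus:
  assumes f: "f \<in> carrier (free_module R S)"
  shows "\<ominus>\<^bsub>free_module R S\<^esub> f = (\<lambda>x. \<ominus> f x)"
proof -
  interpret F: module R "free_module R S" by (rule free_module_is_module)
  have "\<ominus>\<^bsub>free_module R S\<^esub> f = (\<ominus> \<one>) \<odot>\<^bsub>free_module R S\<^esub> f"
    using F.smult_l_minus[OF one_closed f] F.smult_one[OF f] by simp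
  also have "\<dots> = (\<lambda>x. \<ominus> f x)"
    using free_module_carrierD(1)[OF f] by (auto simp: free_module_def l_minus)
  finally show ?thesis .
qed

lemma basis_vector_carrier: "x \<in> S \<Longrightarrow> basis_vector R x \<in> carrier (free_module R S)"
proof -
  assume "x \<in> S"
  moreover have "{y. basis_vector R x y \<noteq> \<zero>} \<subseteq> {x}" unfolding basis_vector_def by auto
  then have "finite {y. basis_vector R x y \<noteq> \<zero>}" by (meson finite.intros finite_subset)
  ultimately show ?thesis unfolding free_module_def basis_vector_def by auto
qed

section \<open>Kaehler differentials under a retraction\<close>

lemma kaehler_relations_carrier:
  assumes "A \<subseteq> carrier R"
  shows "kaehler_relations R A \<subseteq> carrier (free_module R (carrier R))"
proof -
  interpret F: module R "free_module R (carrier R)" by (rule free_module_is_module)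
  have e: "basis_vector R b \<in> carrier (free_module R (carrier R))" if "b \<in> carrier R" for b
    using basis_vector_carrier[OF that] .
  show ?thesis
    using assms unfolding kaehler_relations_def Let_def
    by (auto intro!: e F.M.minus_closed F.M.a_closed F.smult_closed)
qed

lemma kaehler_kernel_submodule:
  "A \<subseteq> carrier R \<Longrightarrow> submodule (kaehler_kernel R A) R (free_module R (carrier R))"
  unfolding kaehler_kernel_def
  by (rule module.generated_submodule_is_submodule[OF free_module_is_module kaehler_relations_carrier])

end

text \<open>The \<open>\<pi>\<close>-semilinear map of free modules with \<open>d b \<mapsto> d (\<pi> b)\<close>.\<close>

definition free_module_push :: "('a, 'm) ring_scheme \<Rightarrow> ('a \<Rightarrow> 'a) \<Rightarrow> ('a \<Rightarrow> 'a) \<Rightarrow> 'a \<Rightarrow> 'a" where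
  "free_module_push R \<pi> f = (\<lambda>y. \<Oplus>\<^bsub>R\<^esub>x\<in>{x \<in> carrier R. f x \<noteq> \<zero>\<^bsub>R\<^esub> \<and> \<pi> x = y}. \<pi> (f x))"

lemma kaehler_relations_addI:
  assumes "b \<in> carrier B" "c \<in> carrier B"
  defines "F \<equiv> free_module B (carrier B)" and "e \<equiv> basis_vector B"
  shows "e (b \<oplus>\<^bsub>B\<^esub> c) \<ominus>\<^bsub>F\<^esub> (e b \<oplus>\<^bsub>F\<^esub> e c) \<in> kaehler_relations B A"
  unfolding kaehler_relations_def Let_def F_def e_def
  by (intro UnI1 CollectI exI[of _ b] exI[of _ c] conjI refl) (use assms(1,2) in simp_all)

lemma kaehler_relations_multI:
  assumes "b \<in> carrier B" "c \<in> carrier B"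
  defines "F \<equiv> free_module B (carrier B)" and "e \<equiv> basis_vector B"
  shows "e (b \<otimes>\<^bsub>B\<^esub> c) \<ominus>\<^bsub>F\<^esub> (b \<odot>\<^bsub>F\<^esub> e c \<oplus>\<^bsub>F\<^esub> c \<odot>\<^bsub>F\<^esub> e b) \<in> kaehler_relations B A"
  unfolding kaehler_relations_def Let_def F_def e_def
  by (rule UnI1, rule UnI2, intro CollectI exI[of _ b] exI[of _ c] conjI refl) (use assms(1,2) in simp_all)

lemma kaehler_relations_baseI: "a \<in> A \<Longrightarrow> basis_vector B a \<in> kaehler_relations B A"
  unfolding kaehler_relations_def Let_def by (intro UnI2 imageI)

lemma kaehler_relationsE:
  assumes "x \<in> kaehler_relations B A"
  defines "F \<equiv> free_module B (carrier B)" and "e \<equiv> basis_vector B"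
  obtains (add) b c where "b \<in> carrier B" "c \<in> carrier B"
      "x = e (b \<oplus>\<^bsub>B\<^esub> c) \<ominus>\<^bsub>F\<^esub> (e b \<oplus>\<^bsub>F\<^esub> e c)"
    | (mult) b c where "b \<in> carrier B" "c \<in> carrier B"
      "x = e (b \<otimes>\<^bsub>B\<^esub> c) \<ominus>\<^bsub>F\<^esub> (b \<odot>\<^bsub>F\<^esub> e c \<oplus>\<^bsub>F\<^esub> c \<odot>\<^bsub>F\<^esub> e b)"
    | (base) a where "a \<in> A" "x = e a"
  using assms(1) unfolding kaehler_relations_def Let_def F_def e_def
  by (elim UnE CollectE exE conjE imageE) metis+

text \<open>Already on free modules, \<open>free_module_push\<close> is a left inverse of the
  inclusion, and both maps send defining relations to defining relations. The push is only
  \<pi>-semilinear, but it is linear over \<open>C\<close> because \<pi> fixes \<open>C\<close>. The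
  relations \<open>d a = 0\<close> are respected since \<pi> maps \<open>A\<close> into
  \<open>A'\<close> and \<open>A'\<close> is contained in \<open>A\<close>.\<close>

lemma (in cring) kaehler_retract:
  assumes C: "subring C R" and A: "A \<subseteq> carrier R" and A': "A' \<subseteq> C" "A' \<subseteq> A"
    and \<pi>: "\<pi> \<in> carrier R \<rightarrow> C" "\<And>c. c \<in> C \<Longrightarrow> \<pi> c = c" "\<And>a. a \<in> A \<Longrightarrow> \<pi> a \<in> A'"
      "\<And>a b. a \<in> carrier R \<Longrightarrow> b \<in> carrier R \<Longrightarrow> \<pi> (a \<oplus> b) = \<pi> a \<oplus> \<pi> b"
      "\<And>a b. a \<in> carrier R \<Longrightarrow> b \<in> carrier R \<Longrightarrow> \<pi> (a \<otimes> b) = \<pi> a \<otimes> \<pi> b"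
  shows "kaehler_direct_summand (R\<lparr>carrier := C\<rparr>) A' R A"
proof -
  define R' where "R' = R\<lparr>carrier := C\<rparr>"
  have R'[simp]: "carrier R' = C" "add R' = add R" "monoid.mult R' = monoid.mult R" "\<one>\<^bsub>R'\<^esub> = \<one>" "\<zero>\<^bsub>R'\<^esub> = \<zero>"
    unfolding R'_def by simp_all
  have Cc: "c \<in> carrier R" if "c \<in> C" for c using that subringE(1)[OF C] by blast
  have C01: "\<zero> \<in> C" "\<one> \<in> C" using subringE(2,3)[OF C] .
  interpret R': cring R'
    unfolding R'_def using subcring_iff[OF subringE(1)[OF C]] subcringI'[OF C] by simp
  let ?F = "free_module R (carrier R)" and ?F' = "free_module R' (carrier R')"
  interpret F: module R ?F by (rule free_module_is_module)
  interpret F': module R' ?F' by (rule R'.free_module_is_module)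
  have MF: "module R' ?F" unfolding R'_def by (rule F.restrict_scalars[OF C])
  interpret MF: module R' ?F by (rule MF)
  have uminus': "\<ominus>\<^bsub>R'\<^esub> c = \<ominus> c" if "c \<in> C" for c
  proof -
    have "\<ominus> c \<oplus>\<^bsub>R'\<^esub> c = \<zero>\<^bsub>R'\<^esub>" using Cc[OF that] by (simp add: l_neg)
    then show ?thesis using R'.minus_equality[of "\<ominus> c" c] that subringE(5)[OF C] by simp
  qed
  have F'F: "f \<in> carrier ?F" if "f \<in> carrier ?F'" for f
    using that Cc unfolding free_module_def by auto
  have opF': "f \<oplus>\<^bsub>?F'\<^esub> g = f \<oplus>\<^bsub>?F\<^esub> g" "a \<odot>\<^bsub>?F'\<^esub> f = a \<odot>\<^bsub>?F\<^esub> f" "\<zero>\<^bsub>?F'\<^esub> = \<zero>\<^bsub>?F\<^esub>" for f g a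
    unfolding free_module_def by simp_all
  have invF': "\<ominus>\<^bsub>?F'\<^esub> f = \<ominus>\<^bsub>?F\<^esub> f" if f: "f \<in> carrier ?F'" for f
    unfolding free_module_uminus[OF F'F[OF f]] R'.free_module_uminus[OF f]
    using uminus' R'.free_module_carrierD(1)[OF f] by auto
  have minusF': "f \<ominus>\<^bsub>?F'\<^esub> g = f \<ominus>\<^bsub>?F\<^esub> g" if "g \<in> carrier ?F'" for f g
    unfolding a_minus_def invF'[OF that] opF' ..
  have eq: "basis_vector R' x = basis_vector R x" for x unfolding basis_vector_def R' ..
  have e: "basis_vector R x \<in> carrier ?F" if "x \<in> carrier R" for x using basis_vector_carrier that .
  have e': "basis_vector R x \<in> carrier ?F'" if "x \<in> C" for x
    using R'.basis_vector_carrier[of x C] that unfolding eq by simp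
  have \<pi>C: "\<pi> b \<in> C" "\<pi> b \<in> carrier R" if "b \<in> carrier R" for b using \<pi>(1) Cc that by blast+
  have \<pi>0: "\<pi> \<zero> = \<zero>" "\<pi> \<one> = \<one>" using \<pi>(2) C01 by auto
  define r where "r = free_module_push R \<pi>"
  \<comment> \<open>The sum may run over any finite set that contains the support; this lets two
    functions be summed over a common index set.\<close>
  have r_eq: "r f y = (\<Oplus>x\<in>{x \<in> T. \<pi> x = y}. \<pi> (f x))"
    if f: "f \<in> carrier ?F" and T: "finite T" "T \<subseteq> carrier R" "{x. f x \<noteq> \<zero>} \<subseteq> T" for f y T
    unfolding r_def free_module_push_def
    by (rule add.finprod_mono_neutral_cong_left)
      (use T \<pi>0 \<pi>C free_module_carrierD(1)[OF f] in auto)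
  have supp: "finite {x. f x \<noteq> \<zero>}" "{x. f x \<noteq> \<zero>} \<subseteq> carrier R" if f: "f \<in> carrier ?F" for f
    using free_module_carrierD[OF f] by auto
  have r_closed: "r f \<in> carrier ?F'" if f: "f \<in> carrier ?F" for f
  proof -
    let ?T = "{x. f x \<noteq> \<zero>}"
    have v: "r f y = (\<Oplus>x\<in>{x \<in> ?T. \<pi> x = y}. \<pi> (f x))" for y
      by (rule r_eq[OF f supp[OF f]]) simp
    have "r f y \<in> C" for y
    proof -
      have "(\<Oplus>x\<in>D. \<pi> (f x)) \<in> C" if "finite D" for D
        using that
      proof (induction D rule: finite_induct)
        case empty
        show ?case using C01 by simp
      next
        case (insert x D)
        have "(\<Oplus>x\<in>insert x D. \<pi> (f x)) = \<pi> (f x) \<oplus> (\<Oplus>x\<in>D. \<pi> (f x))"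
          by (rule finsum_insert) (use insert \<pi>C free_module_carrierD(1)[OF f] in auto)
        then show ?case using insert \<pi>C free_module_carrierD(1)[OF f] subringE(7)[OF C] by simp
      qed
      then show ?thesis unfolding v using supp[OF f] by simp
    qed
    moreover have z: "r f y = \<zero>" if "y \<notin> \<pi> ` ?T" for y
    proof -
      have "{x \<in> ?T. \<pi> x = y} = {}" using that by auto
      then show ?thesis unfolding v by (simp only: finsum_empty)
    qed
    moreover have "finite {y. r f y \<noteq> \<zero>}"
    proof (rule finite_subset)
      show "{y. r f y \<noteq> \<zero>} \<subseteq> \<pi> ` ?T" using z by blast
      show "finite (\<pi> ` ?T)" using supp(1)[OF f] by simp
    qed
    moreover have "r f y = \<zero>" if "y \<notin> C" for y
    proof (rule z)
      show "y \<notin> \<pi> ` ?T" using that \<pi>C(1) supp(2)[OF f] by (auto simp: subset_iff)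
    qed
    ultimately show ?thesis unfolding free_module_def by simp
  qed
  have r_add: "r (f \<oplus>\<^bsub>?F\<^esub> g) = r f \<oplus>\<^bsub>?F\<^esub> r g" if f: "f \<in> carrier ?F" and g: "g \<in> carrier ?F" for f g
  proof
    fix y
    let ?T = "{x. f x \<noteq> \<zero>} \<union> {x. g x \<noteq> \<zero>}"
    have T: "finite ?T" "?T \<subseteq> carrier R" using supp f g by auto
    have fg: "(f \<oplus>\<^bsub>?F\<^esub> g) x = f x \<oplus> g x" for x unfolding free_module_def by simp
    have "r (f \<oplus>\<^bsub>?F\<^esub> g) y = (\<Oplus>x\<in>{x \<in> ?T. \<pi> x = y}. \<pi> ((f \<oplus>\<^bsub>?F\<^esub> g) x))"
      by (rule r_eq[OF F.M.a_closed[OF f g] T]) (use fg in auto)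
    also have "\<dots> = (\<Oplus>x\<in>{x \<in> ?T. \<pi> x = y}. \<pi> (f x) \<oplus> \<pi> (g x))"
      by (rule finsum_cong')
        (use fg \<pi>(4) \<pi>C free_module_carrierD(1)[OF f] free_module_carrierD(1)[OF g] in auto)
    also have "\<dots> = (\<Oplus>x\<in>{x \<in> ?T. \<pi> x = y}. \<pi> (f x)) \<oplus> (\<Oplus>x\<in>{x \<in> ?T. \<pi> x = y}. \<pi> (g x))"
      by (rule finsum_addf) (use \<pi>C free_module_carrierD(1)[OF f] free_module_carrierD(1)[OF g] in auto)
    also have "\<dots> = r f y \<oplus> r g y"
      using r_eq[OF f T, of y] r_eq[OF g T, of y] by simp
    finally show "r (f \<oplus>\<^bsub>?F\<^esub> g) y = (r f \<oplus>\<^bsub>?F\<^esub> r g) y" unfolding free_module_def by simp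
  qed
  have r_smult: "r (b \<odot>\<^bsub>?F\<^esub> f) = \<pi> b \<odot>\<^bsub>?F\<^esub> r f" if b: "b \<in> carrier R" and f: "f \<in> carrier ?F" for b f
  proof
    fix y
    let ?T = "{x. f x \<noteq> \<zero>}"
    have T: "finite ?T" "?T \<subseteq> carrier R" using supp f by auto
    have bf: "(b \<odot>\<^bsub>?F\<^esub> f) x = b \<otimes> f x" for x unfolding free_module_def by simp
    have "r (b \<odot>\<^bsub>?F\<^esub> f) y = (\<Oplus>x\<in>{x \<in> ?T. \<pi> x = y}. \<pi> ((b \<odot>\<^bsub>?F\<^esub> f) x))"
      by (rule r_eq[OF F.smult_closed[OF b f] T]) (use bf b in auto)
    also have "\<dots> = (\<Oplus>x\<in>{x \<in> ?T. \<pi> x = y}. \<pi> b \<otimes> \<pi> (f x))"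
      by (rule finsum_cong') (use bf b \<pi>(5) \<pi>C free_module_carrierD(1)[OF f] in auto)
    also have "\<dots> = \<pi> b \<otimes> (\<Oplus>x\<in>{x \<in> ?T. \<pi> x = y}. \<pi> (f x))"
      by (rule finsum_rdistr[symmetric]) (use T b \<pi>C free_module_carrierD(1)[OF f] in auto)
    also have "\<dots> = \<pi> b \<otimes> r f y"
      using r_eq[OF f T, of y] by simp
    finally show "r (b \<odot>\<^bsub>?F\<^esub> f) y = (\<pi> b \<odot>\<^bsub>?F\<^esub> r f) y" unfolding free_module_def by simp
  qed
  have r_e: "r (basis_vector R b) = basis_vector R (\<pi> b)" if b: "b \<in> carrier R" for b
  proof
    fix y
    have "r (basis_vector R b) y = (\<Oplus>x\<in>{x \<in> {b}. \<pi> x = y}. \<pi> (basis_vector R b x))"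
      by (rule r_eq[OF e[OF b]]) (use b in \<open>auto simp: basis_vector_def\<close>)
    also have "\<dots> = basis_vector R (\<pi> b) y"
    proof (cases "\<pi> b = y")
      case True
      then have "{x \<in> {b}. \<pi> x = y} = {b}" by auto
      then show ?thesis using True \<pi>0 by (simp add: basis_vector_def)
    next
      case False
      then have "{x \<in> {b}. \<pi> x = y} = {}" by auto
      then show ?thesis using False by (simp only: finsum_empty) (simp add: basis_vector_def)
    qed
    finally show "r (basis_vector R b) y = basis_vector R (\<pi> b) y" .
  qed
  \<comment> \<open>On a function supported in \<open>C\<close> the fibre of \<pi> over
    \<open>y\<close> meets the support in at most \<open>y\<close> itself, since \<pi> fixes
    \<open>C\<close>.\<close>
  have r_id: "r f = f" if f: "f \<in> carrier ?F'" for f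
  proof
    fix y
    let ?T = "{x. f x \<noteq> \<zero>}"
    have fF: "f \<in> carrier ?F" using F'F f .
    have T: "finite ?T" "?T \<subseteq> C"
      using supp(1)[OF fF] R'.free_module_carrierD(2)[OF f] by auto
    then have "?T \<subseteq> carrier R" using Cc by blast
    then have "r f y = (\<Oplus>x\<in>{x \<in> ?T. \<pi> x = y}. \<pi> (f x))"
      by (intro r_eq[OF fF T(1)]) auto
    also have "\<dots> = f y"
    proof (cases "f y = \<zero>")
      case True
      then have "{x \<in> ?T. \<pi> x = y} = {}" using T(2) \<pi>(2) by auto
      then show ?thesis using True by (simp only: finsum_empty)
    next
      case False
      then have "{x \<in> ?T. \<pi> x = y} = {y}" using T(2) \<pi>(2) by auto
      moreover have "f y \<in> C" using R'.free_module_carrierD(1)[OF f] by simp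
      ultimately show ?thesis using \<pi>(2) Cc by (simp add: finsum_insert)
    qed
    finally show "r f y = f y" .
  qed
  have lin_r: "linear_map R' ?F ?F' r"
    unfolding linear_map_def opF' using r_closed r_add r_smult Cc \<pi>(2) by auto
  have lin_i: "linear_map R' ?F' ?F (\<lambda>f. f)"
    unfolding linear_map_def opF' using F'F by auto
  have r_inv: "r (\<ominus>\<^bsub>?F\<^esub> f) = \<ominus>\<^bsub>?F\<^esub> r f" if f: "f \<in> carrier ?F" for f
  proof -
    have "r (\<ominus>\<^bsub>?F\<^esub> f) \<oplus>\<^bsub>?F\<^esub> r f = r \<zero>\<^bsub>?F\<^esub>"
      using r_add[of "\<ominus>\<^bsub>?F\<^esub> f" f] f by (simp add: F.M.l_neg)
    also have "\<dots> = \<zero>\<^bsub>?F\<^esub>" using r_id[OF F'.M.zero_closed] unfolding opF' .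
    finally show ?thesis
      using F.M.minus_equality F'F r_closed f F.M.a_inv_closed by metis
  qed
  have r_minus: "r (f \<ominus>\<^bsub>?F\<^esub> g) = r f \<ominus>\<^bsub>?F\<^esub> r g" if "f \<in> carrier ?F" "g \<in> carrier ?F" for f g
    using r_add r_inv that F.M.a_inv_closed by (metis F.M.minus_eq)
  let ?K = "kaehler_kernel R A" and ?K' = "kaehler_kernel R' A'"
  have K: "submodule ?K R ?F" using kaehler_kernel_submodule[OF A] .
  have K': "submodule ?K' R' ?F'" using R'.kaehler_kernel_submodule A'(1) by simp
  have relK: "kaehler_relations R A \<subseteq> ?K"
    unfolding kaehler_kernel_def by (rule F.generated_submodule_incl)
  have relK': "kaehler_relations R' A' \<subseteq> ?K'"
    unfolding kaehler_kernel_def by (rule F'.generated_submodule_incl)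
  \<comment> \<open>The relations of the small ring are stated with the operations of its own free
    module. This and the next two claims restate them with the operations of the large one.\<close>
  have rel_add: "basis_vector R (b \<oplus> c) \<ominus>\<^bsub>?F\<^esub> (basis_vector R b \<oplus>\<^bsub>?F\<^esub> basis_vector R c) \<in> kaehler_relations R' A'"
    if "b \<in> C" "c \<in> C" for b c
  proof -
    have "basis_vector R b \<oplus>\<^bsub>?F'\<^esub> basis_vector R c \<in> carrier ?F'"
      using e' that F'.M.a_closed by blast
    then have "basis_vector R' (b \<oplus>\<^bsub>R'\<^esub> c) \<ominus>\<^bsub>?F'\<^esub> (basis_vector R' b \<oplus>\<^bsub>?F'\<^esub> basis_vector R' c) =
      basis_vector R (b \<oplus> c) \<ominus>\<^bsub>?F\<^esub> (basis_vector R b \<oplus>\<^bsub>?F\<^esub> basis_vector R c)"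
      unfolding eq using minusF' opF' by simp
    then show ?thesis using kaehler_relations_addI[of b R' c A'] that R'(1) by metis
  qed
  have rel_mult: "basis_vector R (b \<otimes> c) \<ominus>\<^bsub>?F\<^esub> (b \<odot>\<^bsub>?F\<^esub> basis_vector R c \<oplus>\<^bsub>?F\<^esub> c \<odot>\<^bsub>?F\<^esub> basis_vector R b)
      \<in> kaehler_relations R' A'"
    if "b \<in> C" "c \<in> C" for b c
  proof -
    have "b \<odot>\<^bsub>?F'\<^esub> basis_vector R c \<oplus>\<^bsub>?F'\<^esub> c \<odot>\<^bsub>?F'\<^esub> basis_vector R b \<in> carrier ?F'"
      using e' that F'.M.a_closed F'.smult_closed R'(1) by simp
    then have "basis_vector R' (b \<otimes>\<^bsub>R'\<^esub> c) \<ominus>\<^bsub>?F'\<^esub>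
        (b \<odot>\<^bsub>?F'\<^esub> basis_vector R' c \<oplus>\<^bsub>?F'\<^esub> c \<odot>\<^bsub>?F'\<^esub> basis_vector R' b) =
      basis_vector R (b \<otimes> c) \<ominus>\<^bsub>?F\<^esub> (b \<odot>\<^bsub>?F\<^esub> basis_vector R c \<oplus>\<^bsub>?F\<^esub> c \<odot>\<^bsub>?F\<^esub> basis_vector R b)"
      unfolding eq using minusF' opF' by simp
    then show ?thesis using kaehler_relations_multI[of b R' c A'] that R'(1) by metis
  qed
  have rel_base: "basis_vector R a \<in> kaehler_relations R' A'" if "a \<in> A'" for a
    using kaehler_relations_baseI[OF that, of R'] unfolding eq .
  have rK: "r f \<in> ?K'" if f: "f \<in> ?K" for f
  proof -
    \<comment> \<open>The preimage of the small kernel is a submodule over the whole of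
      \<open>R\<close>: scaling by \<open>a\<close> becomes scaling by \<open>\<pi> a\<close>, which
      lies in \<open>C\<close>. It then suffices to check the generating relations.\<close>
    let ?N = "{f \<in> carrier ?F. r f \<in> ?K'}"
    have KE: "\<ominus>\<^bsub>?F\<^esub> x \<in> ?K'" "x \<oplus>\<^bsub>?F\<^esub> y \<in> ?K'" "a \<in> C \<Longrightarrow> a \<odot>\<^bsub>?F\<^esub> x \<in> ?K'"
      if "x \<in> ?K'" "y \<in> ?K'" for x y a
    proof -
      have "x \<in> carrier ?F'" using F'.submoduleE(1)[OF K'] that by blast
      then show "\<ominus>\<^bsub>?F\<^esub> x \<in> ?K'" using F'.submoduleE(3)[OF K' that(1)] invF' by simp
      show "x \<oplus>\<^bsub>?F\<^esub> y \<in> ?K'" using F'.submoduleE(5)[OF K' that] unfolding opF' .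
      show "a \<in> C \<Longrightarrow> a \<odot>\<^bsub>?F\<^esub> x \<in> ?K'" using F'.submoduleE(4)[OF K' _ that(1), of a] opF' by simp
    qed
    have "submodule ?N R ?F"
    proof (rule F.submoduleI)
      have "\<zero>\<^bsub>?F'\<^esub> \<in> ?K'" using subgroup.one_closed[OF submodule.axioms(1)[OF K']] by simp
      then show "\<zero>\<^bsub>?F\<^esub> \<in> ?N" using r_id[OF F'.M.zero_closed] unfolding opF' by simp
      show "\<ominus>\<^bsub>?F\<^esub> x \<in> ?N" if "x \<in> ?N" for x using that r_inv[of x] KE(1)[of "r x" "r x"] by simp
      show "x \<oplus>\<^bsub>?F\<^esub> y \<in> ?N" if "x \<in> ?N" "y \<in> ?N" for x y using that r_add KE(2) by simp
      show "a \<odot>\<^bsub>?F\<^esub> x \<in> ?N" if "a \<in> carrier R" "x \<in> ?N" for a x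
        using that r_smult[of a x] KE(3)[of "r x" "r x" "\<pi> a"] \<pi>C by simp
    qed blast
    moreover have "kaehler_relations R A \<subseteq> ?N"
    proof
      fix x assume x: "x \<in> kaehler_relations R A"
      have xF: "x \<in> carrier ?F" using kaehler_relations_carrier[OF A] x by blast
      from x have "r x \<in> kaehler_relations R' A'"
      proof (cases rule: kaehler_relationsE)
        case (add b c)
        then have "r x = basis_vector R (\<pi> b \<oplus> \<pi> c) \<ominus>\<^bsub>?F\<^esub> (basis_vector R (\<pi> b) \<oplus>\<^bsub>?F\<^esub> basis_vector R (\<pi> c))"
          using r_minus r_add r_e e \<pi>(4) F.M.a_closed by simp
        then show ?thesis using rel_add \<pi>C add by simp
      next
        case (mult b c)
        then have "r x = basis_vector R (\<pi> b \<otimes> \<pi> c) \<ominus>\<^bsub>?F\<^esub>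
            (\<pi> b \<odot>\<^bsub>?F\<^esub> basis_vector R (\<pi> c) \<oplus>\<^bsub>?F\<^esub> \<pi> c \<odot>\<^bsub>?F\<^esub> basis_vector R (\<pi> b))"
          using r_minus r_add r_smult r_e e \<pi>(5) F.M.a_closed F.smult_closed by simp
        then show ?thesis using rel_mult \<pi>C mult by simp
      next
        case (base a)
        then show ?thesis using r_e A \<pi>(3) rel_base by (metis subsetD)
      qed
      then show "x \<in> ?N" using xF relK' by blast
    qed
    ultimately have "?K \<subseteq> ?N" unfolding kaehler_kernel_def by (rule F.generated_submodule_least)
    then show ?thesis using f by blast
  qed
  have K'K: "f \<in> ?K" if f: "f \<in> ?K'" for f
  proof -
    let ?N = "{f \<in> carrier ?F'. f \<in> ?K}"
    have "submodule ?N R' ?F'"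
    proof (rule F'.submoduleI)
      have "\<zero>\<^bsub>?F\<^esub> \<in> ?K" using subgroup.one_closed[OF submodule.axioms(1)[OF K]] by simp
      then show "\<zero>\<^bsub>?F'\<^esub> \<in> ?N" using F'.M.zero_closed unfolding opF' by simp
      show "\<ominus>\<^bsub>?F'\<^esub> x \<in> ?N" if "x \<in> ?N" for x
        using that F.submoduleE(3)[OF K, of x] F'.M.a_inv_closed[of x] invF'[of x] by simp
      show "x \<oplus>\<^bsub>?F'\<^esub> y \<in> ?N" if "x \<in> ?N" "y \<in> ?N" for x y
        using that F.submoduleE(5)[OF K, of x y] F'.M.a_closed[of x y] opF'(1)[of x y] by simp
      show "a \<odot>\<^bsub>?F'\<^esub> x \<in> ?N" if "a \<in> carrier R'" "x \<in> ?N" for a x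
        using that F.submoduleE(4)[OF K, of a x] F'.smult_closed[of a x] Cc[of a] opF'(2)[of a x] by simp
    qed blast
    moreover have "kaehler_relations R' A' \<subseteq> ?N"
    proof
      fix x assume x: "x \<in> kaehler_relations R' A'"
      have xF: "x \<in> carrier ?F'" using R'.kaehler_relations_carrier[of A'] A'(1) x by auto
      from x have "x \<in> kaehler_relations R A"
      proof (cases rule: kaehler_relationsE)
        case (add b c)
        have "basis_vector R b \<oplus>\<^bsub>?F'\<^esub> basis_vector R c \<in> carrier ?F'"
          using e' add(1,2) F'.M.a_closed R'(1) by simp
        then have "x = basis_vector R (b \<oplus> c) \<ominus>\<^bsub>?F\<^esub> (basis_vector R b \<oplus>\<^bsub>?F\<^esub> basis_vector R c)"
          using add(3) minusF' opF' unfolding eq by simp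
        then show ?thesis using kaehler_relations_addI[of b R c A] add(1,2) Cc R'(1) by metis
      next
        case (mult b c)
        have "b \<odot>\<^bsub>?F'\<^esub> basis_vector R c \<oplus>\<^bsub>?F'\<^esub> c \<odot>\<^bsub>?F'\<^esub> basis_vector R b \<in> carrier ?F'"
          using e' mult(1,2) F'.M.a_closed F'.smult_closed R'(1) by simp
        then have "x = basis_vector R (b \<otimes> c) \<ominus>\<^bsub>?F\<^esub>
            (b \<odot>\<^bsub>?F\<^esub> basis_vector R c \<oplus>\<^bsub>?F\<^esub> c \<odot>\<^bsub>?F\<^esub> basis_vector R b)"
          using mult(3) minusF' opF' unfolding eq by simp
        then show ?thesis using kaehler_relations_multI[of b R c A] mult(1,2) Cc R'(1) by metis
      next
        case (base a)
        then show ?thesis using kaehler_relations_baseI[of a A R] A'(2) unfolding eq by blast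
      qed
      then show "x \<in> ?N" using xF relK by blast
    qed
    ultimately have "?K' \<subseteq> ?N" unfolding kaehler_kernel_def by (rule F'.generated_submodule_least)
    then show ?thesis using f by blast
  qed
  have KR': "submodule ?K R' ?F"
    unfolding R'_def by (rule F.submodule_restrict_scalars[OF subringE(1)[OF C] K])
  obtain h where h: "linear_map R' (quotient_module ?F' ?K') (quotient_module ?F ?K) h"
    "\<And>x. x \<in> carrier ?F' \<Longrightarrow> h (?K' +>\<^bsub>?F'\<^esub> x) = ?K +>\<^bsub>?F\<^esub> x"
    "inj_on h (carrier (quotient_module ?F' ?K'))"
    "direct_summand (h ` carrier (quotient_module ?F' ?K')) R' (quotient_module ?F ?K)"
    using MF.quotient_retract_direct_summand[OF F'.module_axioms KR' K' lin_i lin_r r_id K'K rK] by blast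
  have "h (kaehler_d R' A' b) = kaehler_d R A b" if "b \<in> carrier R'" for b
    unfolding kaehler_d_def eq using h(2) e' that by simp
  then show ?thesis
    unfolding kaehler_direct_summand_def R'_def[symmetric] kaehler_def using h(1,3,4) by blast
qed

section \<open>Power series and the vanishing of variables\<close>

context cring
begin

lemma power_series_carrierD:
  assumes "f \<in> carrier (power_series_ring R I)"
  shows "f m \<in> carrier R" "\<not> set_mset m \<subseteq> I \<Longrightarrow> f m = \<zero>"
  using assms unfolding power_series_ring_def by auto

lemma power_series_carrier_mono:
  "I \<subseteq> J \<Longrightarrow> carrier (power_series_ring R I) \<subseteq> carrier (power_series_ring R J)"
  unfolding power_series_ring_def by auto

text \<open>The variables of \<open>m\<close> are those of \<open>k\<close> together with those of
  \<open>m - k\<close>. If \<open>m\<close> involves a variable outside \<open>I\<close>, so does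
  one of the two parts, and every term of the convolution vanishes.\<close>

lemma power_series_mult_outside:
  assumes "f \<in> carrier (power_series_ring R I)" "g \<in> carrier (power_series_ring R I)"
    and "\<not> set_mset m \<subseteq> I"
  shows "(f \<otimes>\<^bsub>power_series_ring R I\<^esub> g) m = \<zero>"
proof -
  have "f k \<otimes> g (m - k) = \<zero>" if "k \<subseteq># m" for k
  proof -
    have "set_mset m = set_mset k \<union> set_mset (m - k)"
      using that by (metis set_mset_union subset_mset.add_diff_inverse)
    then have "\<not> set_mset k \<subseteq> I \<or> \<not> set_mset (m - k) \<subseteq> I" using assms(3) by blast
    then show ?thesis using power_series_carrierD assms(1,2) by (metis l_null r_null)
  qed
  then show ?thesis
    unfolding power_series_ring_def by simp (intro add.finprod_one_eqI, simp)
qed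

lemma power_series_mult_closed:
  assumes f: "f \<in> carrier (power_series_ring R I)" and g: "g \<in> carrier (power_series_ring R I)"
  shows "f \<otimes>\<^bsub>power_series_ring R I\<^esub> g \<in> carrier (power_series_ring R I)"
proof -
  have "(f \<otimes>\<^bsub>power_series_ring R I\<^esub> g) m \<in> carrier R" for m
    using power_series_carrierD(1)[OF f] power_series_carrierD(1)[OF g]
    unfolding power_series_ring_def by (auto intro: finsum_closed)
  moreover have "(f \<otimes>\<^bsub>power_series_ring R I\<^esub> g) m = \<zero>" if "\<not> set_mset m \<subseteq> I" for m
    using power_series_mult_outside[OF f g that] .
  ultimately show ?thesis by (simp add: power_series_ring_def)
qed

lemma power_series_add_closed:
  "f \<in> carrier (power_series_ring R I) \<Longrightarrow> g \<in> carrier (power_series_ring R I) \<Longrightarrow>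
    f \<oplus>\<^bsub>power_series_ring R I\<^esub> g \<in> carrier (power_series_ring R I)"
  unfolding power_series_ring_def by auto

lemma indexed_const_power_series:
  "c \<in> carrier R \<Longrightarrow> indexed_const c \<in> carrier (power_series_ring R I)"
  unfolding power_series_ring_def indexed_const_def by auto

text \<open>On coefficients this is the substitution of zero for all variables outside
  \<open>I\<close>.\<close>

definition restrict_series :: "'x set \<Rightarrow> ('x multiset \<Rightarrow> 'a) \<Rightarrow> 'x multiset \<Rightarrow> 'a"
  where "restrict_series I f = (\<lambda>m. if set_mset m \<subseteq> I then f m else \<zero>)"

lemma restrict_series_closed:
  "f \<in> carrier (power_series_ring R J) \<Longrightarrow> restrict_series I f \<in> carrier (power_series_ring R I)"
  unfolding power_series_ring_def restrict_series_def by auto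

lemma restrict_series_id:
  "f \<in> carrier (power_series_ring R I) \<Longrightarrow> restrict_series I f = f"
  unfolding power_series_ring_def restrict_series_def by auto

lemma restrict_series_add:
  "restrict_series I (f \<oplus>\<^bsub>power_series_ring R J\<^esub> g) =
    restrict_series I f \<oplus>\<^bsub>power_series_ring R J\<^esub> restrict_series I g"
  unfolding power_series_ring_def restrict_series_def by auto

text \<open>A divisor of a monomial in the variables \<open>I\<close> is again such a monomial, so
  those coefficients of the product involve only retained coefficients. At all other monomials both
  sides vanish.\<close>

lemma restrict_series_mult:
  assumes f: "f \<in> carrier (power_series_ring R J)" and g: "g \<in> carrier (power_series_ring R J)"
  shows "restrict_series I (f \<otimes>\<^bsub>power_series_ring R J\<^esub> g) =
    restrict_series I f \<otimes>\<^bsub>power_series_ring R J\<^esub> restrict_series I g"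
proof
  fix m
  show "restrict_series I (f \<otimes>\<^bsub>power_series_ring R J\<^esub> g) m =
    (restrict_series I f \<otimes>\<^bsub>power_series_ring R J\<^esub> restrict_series I g) m"
  proof (cases "set_mset m \<subseteq> I")
    case True
    have "f k \<otimes> g (m - k) = restrict_series I f k \<otimes> restrict_series I g (m - k)" if "k \<subseteq># m" for k
    proof -
      have "set_mset k \<subseteq> I" "set_mset (m - k) \<subseteq> I"
        using True set_mset_mono[OF that] in_diffD by fastforce+
      then show ?thesis unfolding restrict_series_def by simp
    qed
    then have "(\<Oplus>k\<in>{k. k \<subseteq># m}. f k \<otimes> g (m - k)) =
        (\<Oplus>k\<in>{k. k \<subseteq># m}. restrict_series I f k \<otimes> restrict_series I g (m - k))"
      using power_series_carrierD(1)[OF f] power_series_carrierD(1)[OF g]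
      by (intro finsum_cong') (auto simp: restrict_series_def)
    then show ?thesis
      using True unfolding power_series_ring_def by (simp add: restrict_series_def)
  next
    case False
    have "(restrict_series I f \<otimes>\<^bsub>power_series_ring R I\<^esub> restrict_series I g) m = \<zero>"
      using power_series_mult_outside False restrict_series_closed f g by blast
    then show ?thesis
      using False unfolding power_series_ring_def by (simp add: restrict_series_def)
  qed
qed

end

section \<open>Transfer to the absolute integral closures\<close>

text \<open>The smaller closure is formed inside \<open>B\<close>, but the retraction is built from
  integral elements of the ambient field; this identifies the two notions.\<close>

lemma (in ring) integral_over_consistent:
  assumes "subring S R"
  shows "integral_over (R\<lparr>carrier := S\<rparr>) A x \<longleftrightarrow> integral_over R A x"
  unfolding integral_over_def eval_consistent[OF assms] univ_poly_def polynomial_def by simp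

lemma (in ring) integral_over_mono: "A \<subseteq> A' \<Longrightarrow> integral_over R A x \<Longrightarrow> integral_over R A' x"
  unfolding integral_over_def univ_poly_def polynomial_def by auto

lemma (in ring) subring_of_subring:
  assumes S: "subring S R" and T: "subring T R" "T \<subseteq> S"
  shows "subring T (R\<lparr>carrier := S\<rparr>)"
proof -
  interpret S: ring "R\<lparr>carrier := S\<rparr>" using subring_is_ring[OF S] .
  show ?thesis
    using S.subring_iff[of T] T subring_is_ring[OF T(1)] by simp
qed

text \<open>Both characteristics are covered at once by a commutative coefficient ring and variable
  sets \<open>I \<subseteq> J\<close>. The two conclusions apply \<open>kaehler_retract\<close> with
  the same \<pi>, once over the constants and once over the power series rings.\<close>

lemma kaehler_direct_summand_power_series:
  fixes V :: "('v, 'a) ring_scheme" and L :: "('l, 'b) ring_scheme"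
    and I J :: "'x set"
  assumes V: "cring V" and IJ: "I \<subseteq> J"
    and closure: "algebraic_closure_of_fractions L \<phi> (power_series_ring V J)"
  defines "A \<equiv> \<phi> ` carrier (power_series_ring V J)" and "A' \<equiv> \<phi> ` carrier (power_series_ring V I)"
    and "V\<^sub>0 \<equiv> \<phi> ` ring.indexed_const V ` carrier V"
  shows "kaehler_direct_summand (integral_closure (integral_closure L A) A') V\<^sub>0 (integral_closure L A) V\<^sub>0"
    and "kaehler_direct_summand (integral_closure (integral_closure L A) A') A' (integral_closure L A) A"
proof -
  interpret V: cring V by (rule V)
  let ?P = "power_series_ring V"
  have hom: "\<phi> \<in> ring_hom (?P J) L" and inj: "inj_on \<phi> (carrier (?P J))"
    and cl: "algebraic_closure L (generate_field L A)"
    using closure unfolding algebraic_closure_of_fractions_def A_def by auto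
  interpret L: field L using cl by (rule algebraic_closure.axioms(1))
  have sub: "f \<in> carrier (?P J)" if "f \<in> carrier (?P I)" for f
    using V.power_series_carrier_mono[OF IJ] that by blast
  have \<phi>c: "\<phi> f \<in> carrier L" if "f \<in> carrier (?P J)" for f using ring_hom_closed[OF hom that] .
  \<comment> \<open>Only the carrier depends on the variable set, so the homomorphism on the large
    ring can be used on each smaller one.\<close>
  have ops: "(\<oplus>\<^bsub>?P H\<^esub>) = (\<oplus>\<^bsub>?P J\<^esub>)" "(\<otimes>\<^bsub>?P H\<^esub>) = (\<otimes>\<^bsub>?P J\<^esub>)" "\<one>\<^bsub>?P H\<^esub> = \<one>\<^bsub>?P J\<^esub>" for H
    unfolding power_series_ring_def by simp_all
  have subring: "subring (\<phi> ` carrier (?P H)) L" if H: "H \<subseteq> J" for H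
  proof (rule L.subringI)
    have HJ: "f \<in> carrier (?P J)" if "f \<in> carrier (?P H)" for f
      using V.power_series_carrier_mono[OF H] that by blast
    show "\<phi> ` carrier (?P H) \<subseteq> carrier L" using \<phi>c HJ by blast
    have "\<one>\<^bsub>?P J\<^esub> \<in> carrier (?P H)"
      using V.indexed_const_power_series[OF V.one_closed] by (simp add: power_series_ring_def)
    then show "\<one>\<^bsub>L\<^esub> \<in> \<phi> ` carrier (?P H)" using ring_hom_one[OF hom] by (metis imageI)
    show "a \<otimes>\<^bsub>L\<^esub> b \<in> \<phi> ` carrier (?P H)" if ab: "a \<in> \<phi> ` carrier (?P H)" "b \<in> \<phi> ` carrier (?P H)" for a b
    proof -
      obtain f g where fg: "f \<in> carrier (?P H)" "a = \<phi> f" "g \<in> carrier (?P H)" "b = \<phi> g" using ab by blast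
      have "\<phi> (f \<otimes>\<^bsub>?P J\<^esub> g) = a \<otimes>\<^bsub>L\<^esub> b" using ring_hom_mult[OF hom] fg HJ by simp
      moreover have "f \<otimes>\<^bsub>?P J\<^esub> g \<in> carrier (?P H)"
        using V.power_series_mult_closed[OF fg(1,3)] unfolding ops[of H] .
      ultimately show ?thesis by (metis imageI)
    qed
    have add: "a \<oplus>\<^bsub>L\<^esub> b \<in> \<phi> ` carrier (?P H)" if ab: "a \<in> \<phi> ` carrier (?P H)" "b \<in> \<phi> ` carrier (?P H)" for a b
    proof -
      obtain f g where fg: "f \<in> carrier (?P H)" "a = \<phi> f" "g \<in> carrier (?P H)" "b = \<phi> g" using ab by blast
      have "\<phi> (f \<oplus>\<^bsub>?P J\<^esub> g) = a \<oplus>\<^bsub>L\<^esub> b" using ring_hom_add[OF hom] fg HJ by simp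
      moreover have "f \<oplus>\<^bsub>?P J\<^esub> g \<in> carrier (?P H)"
        using V.power_series_add_closed[OF fg(1,3)] unfolding ops[of H] .
      ultimately show ?thesis by (metis imageI)
    qed
    then show "a \<oplus>\<^bsub>L\<^esub> b \<in> \<phi> ` carrier (?P H)" if "a \<in> \<phi> ` carrier (?P H)" "b \<in> \<phi> ` carrier (?P H)" for a b
      using that .
    fix a assume "a \<in> \<phi> ` carrier (?P H)"
    then obtain f where f: "f \<in> carrier (?P H)" "a = \<phi> f" by blast
    \<comment> \<open>Membership in \<open>ring_hom\<close> covers sums, products and one, but not
      zero or negatives. These are recovered by hand: the zero series satisfies
      \<open>z + z = z\<close>, so its image is zero, and the pointwise negative then maps to the
      negative.\<close>
    define g where "g m = \<ominus>\<^bsub>V\<^esub> f m" for m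
    define z :: "'x multiset \<Rightarrow> 'v" where "z = (\<lambda>m. \<zero>\<^bsub>V\<^esub>)"
    have g: "g \<in> carrier (?P H)" and z: "z \<in> carrier (?P J)"
      using f(1) unfolding power_series_ring_def g_def z_def by auto
    have "\<phi> z \<oplus>\<^bsub>L\<^esub> \<phi> z = \<phi> z"
      using ring_hom_add[OF hom z z] by (simp add: power_series_ring_def z_def)
    then have "\<phi> z = \<zero>\<^bsub>L\<^esub>" using \<phi>c[OF z] by simp
    moreover have "g \<oplus>\<^bsub>?P J\<^esub> f = z"
      using f(1) unfolding power_series_ring_def g_def z_def by (auto simp: V.l_neg)
    ultimately have "\<phi> g \<oplus>\<^bsub>L\<^esub> a = \<zero>\<^bsub>L\<^esub>" using ring_hom_add[OF hom HJ[OF g] HJ[OF f(1)]] f(2) by simp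
    then have "\<ominus>\<^bsub>L\<^esub> a = \<phi> g"
      using L.minus_equality \<phi>c HJ f g by metis
    then show "\<ominus>\<^bsub>L\<^esub> a \<in> \<phi> ` carrier (?P H)" using g by blast
  qed
  have A: "subring A L" "subring A' L" unfolding A_def A'_def using subring IJ by blast+
  have A'A: "A' \<subseteq> A" unfolding A_def A'_def using sub by blast
  have V0: "V\<^sub>0 \<subseteq> A'" unfolding V\<^sub>0_def A'_def using V.indexed_const_power_series by blast
  define \<rho> where "\<rho> = V.restrict_series I"
  \<comment> \<open>The substitution of zero is transported to the image in \<open>L\<close>;
    injectivity of \<open>\<phi>\<close> makes the preimage unambiguous.\<close>
  define \<tau> where "\<tau> a = \<phi> (\<rho> (inv_into (carrier (?P J)) \<phi> a))" for a
  have \<tau>\<phi>: "\<tau> (\<phi> f) = \<phi> (\<rho> f)" if "f \<in> carrier (?P J)" for f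
    unfolding \<tau>_def using inv_into_f_f[OF inj that] by simp
  have \<rho>: "\<rho> f \<in> carrier (?P I)" if "f \<in> carrier (?P J)" for f
    unfolding \<rho>_def using V.restrict_series_closed[OF that] .
  have \<tau>_add: "\<tau> (a \<oplus>\<^bsub>L\<^esub> b) = \<tau> a \<oplus>\<^bsub>L\<^esub> \<tau> b" if ab: "a \<in> A" "b \<in> A" for a b
  proof -
    obtain f g where fg: "f \<in> carrier (?P J)" "a = \<phi> f" "g \<in> carrier (?P J)" "b = \<phi> g"
      using ab unfolding A_def by blast
    have "\<tau> (\<phi> (f \<oplus>\<^bsub>?P J\<^esub> g)) = \<phi> (\<rho> f \<oplus>\<^bsub>?P J\<^esub> \<rho> g)"
      unfolding \<tau>\<phi>[OF V.power_series_add_closed[OF fg(1,3)]] \<rho>_def V.restrict_series_add ..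
    then show ?thesis
      unfolding fg(2,4) \<tau>\<phi>[OF fg(1)] \<tau>\<phi>[OF fg(3)] ring_hom_add[OF hom fg(1,3)]
        ring_hom_add[OF hom sub[OF \<rho>[OF fg(1)]] sub[OF \<rho>[OF fg(3)]]] .
  qed
  have \<tau>_mult: "\<tau> (a \<otimes>\<^bsub>L\<^esub> b) = \<tau> a \<otimes>\<^bsub>L\<^esub> \<tau> b" if ab: "a \<in> A" "b \<in> A" for a b
  proof -
    obtain f g where fg: "f \<in> carrier (?P J)" "a = \<phi> f" "g \<in> carrier (?P J)" "b = \<phi> g"
      using ab unfolding A_def by blast
    have "\<tau> (\<phi> (f \<otimes>\<^bsub>?P J\<^esub> g)) = \<phi> (\<rho> f \<otimes>\<^bsub>?P J\<^esub> \<rho> g)"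
      unfolding \<tau>\<phi>[OF V.power_series_mult_closed[OF fg(1,3)]] \<rho>_def V.restrict_series_mult[OF fg(1,3)] ..
    then show ?thesis
      unfolding fg(2,4) \<tau>\<phi>[OF fg(1)] \<tau>\<phi>[OF fg(3)] ring_hom_mult[OF hom fg(1,3)]
        ring_hom_mult[OF hom sub[OF \<rho>[OF fg(1)]] sub[OF \<rho>[OF fg(3)]]] .
  qed
  have \<tau>A: "\<tau> \<in> A \<rightarrow> A'" unfolding A_def A'_def using \<tau>\<phi> \<rho> by auto
  have \<tau>_id: "\<tau> a = a" if a: "a \<in> A'" for a
  proof -
    obtain f where f: "f \<in> carrier (?P I)" "a = \<phi> f" using a unfolding A'_def by blast
    show ?thesis unfolding f(2) \<tau>\<phi>[OF sub[OF f(1)]] \<rho>_def V.restrict_series_id[OF f(1)] ..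
  qed
  \<comment> \<open>The coefficients lie in the fraction field of the large ring, over which
    \<open>L\<close> is an algebraic closure. No separate closure for the smaller ring
    enters.\<close>
  have splitted: "L.splitted p" if p: "p \<in> carrier (univ_poly L A')" for p
  proof -
    have "A' \<subseteq> generate_field L A" 
      by (rule subsetI, rule generate_field.incl, rule subsetD[OF A'A])
    then have "p \<in> carrier (univ_poly L (generate_field L A))"
      using p unfolding univ_poly_def polynomial_def by auto
    then show ?thesis by (rule algebraic_closure.roots_over_subfield[OF cl])
  qed
  define B where "B = {x \<in> carrier L. integral_over L A x}"
  define B' where "B' = {x \<in> carrier L. integral_over L A' x}"
  obtain \<pi> where \<pi>: "\<pi> \<in> B \<rightarrow> B'" "\<And>b. b \<in> B' \<Longrightarrow> \<pi> b = b" "\<And>a. a \<in> A \<Longrightarrow> \<pi> a \<in> A'"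
    "\<And>a b. a \<in> B \<Longrightarrow> b \<in> B \<Longrightarrow> \<pi> (a \<oplus>\<^bsub>L\<^esub> b) = \<pi> a \<oplus>\<^bsub>L\<^esub> \<pi> b"
    "\<And>a b. a \<in> B \<Longrightarrow> b \<in> B \<Longrightarrow> \<pi> (a \<otimes>\<^bsub>L\<^esub> b) = \<pi> a \<otimes>\<^bsub>L\<^esub> \<pi> b"
    using L.integral_closure_retraction[OF A A'A \<tau>A \<tau>_id \<tau>_add \<tau>_mult splitted B_def B'_def] by metis
  have B: "subring B L" "subring B' L"
    unfolding B_def B'_def using L.subring_integral_closure A by blast+
  have B'B: "B' \<subseteq> B" unfolding B_def B'_def using L.integral_over_mono[OF A'A] by blast
  have base: "a \<in> {x \<in> carrier L. integral_over L D x}" if D: "subring D L" and a: "a \<in> D" for D a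
    using L.monic_value_zero_base[OF D a] L.integral_over_iff[OF D] a subringE(1)[OF D] by blast
  have AB: "A \<subseteq> B" "A' \<subseteq> B'" unfolding B_def B'_def using base A by blast+
  let ?S = "L\<lparr>carrier := B\<rparr>"
  have S: "integral_closure L A = ?S" unfolding integral_closure_def B_def ..
  have S': "integral_closure ?S A' = ?S\<lparr>carrier := B'\<rparr>"
  proof -
    have "{x \<in> carrier ?S. integral_over ?S A' x} = B'"
      unfolding L.integral_over_consistent[OF B(1)] using B'B B'_def subringE(1)[OF B(1)] by auto
    then show ?thesis unfolding integral_closure_def by simp
  qed
  interpret S: cring ?S
    using L.subcring_iff[OF subringE(1)[OF B(1)]] L.subcringI'[OF B(1)] by simp
  have C: "subring B' ?S" using L.subring_of_subring[OF B B'B] .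
  have retract: "kaehler_direct_summand (?S\<lparr>carrier := B'\<rparr>) D' ?S D"
    if "D' \<subseteq> A'" "D' \<subseteq> D" "D \<subseteq> A" "\<And>a. a \<in> D \<Longrightarrow> \<pi> a \<in> D'" for D D'
    by (rule S.kaehler_retract[OF C, of D D' \<pi>]) (use that AB \<pi> in auto)
  show "kaehler_direct_summand (integral_closure (integral_closure L A) A') A' (integral_closure L A) A"
    unfolding S S' by (rule retract) (use A'A \<pi>(3) in auto)
  \<comment> \<open>Constants lie in \<open>A'\<close> and hence in \<open>B'\<close>, where \<pi>
    is the identity; this is the compatibility required over the base
    \<open>V\<^sub>0\<close>.\<close>
  have "\<pi> a = a" if "a \<in> V\<^sub>0" for a using \<pi>(2) that V0 AB by blast
  then show "kaehler_direct_summand (integral_closure (integral_closure L A) A') V\<^sub>0 (integral_closure L A) V\<^sub>0"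
    unfolding S S' by (intro retract) (use A'A V0 in auto)
qed

text \<open>Each case takes \<open>{1..i}\<close> inside the full set of variables in
  \<open>kaehler_direct_summand_power_series\<close>. For \<open>i = 0\<close> this set is empty and
  the series are the constants, in agreement with the convention for the zeroth ring.\<close>

theorem mainTheorem16:
  fixes V :: "('v, 'a) ring_scheme" and L :: "('l, 'b) ring_scheme"
    and \<phi> :: "(nat multiset \<Rightarrow> 'v) \<Rightarrow> 'l"
    and k :: "('k, 'c) ring_scheme" and L' :: "('m, 'd) ring_scheme"
    and \<psi> :: "(nat multiset \<Rightarrow> 'k) \<Rightarrow> 'm"
    and p n n' :: nat
  shows
   "(discrete_valuation_ring V \<and>
     prime p \<and> has_characteristic V 0 \<and>
     has_characteristic (V Quot (PIdl\<^bsub>V\<^esub> ([p] \<cdot>\<^bsub>V\<^esub> \<one>\<^bsub>V\<^esub>))) p \<and>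
     maximalideal (PIdl\<^bsub>V\<^esub> ([p] \<cdot>\<^bsub>V\<^esub> \<one>\<^bsub>V\<^esub>)) V \<and>
     adically_complete V (PIdl\<^bsub>V\<^esub> ([p] \<cdot>\<^bsub>V\<^esub> \<one>\<^bsub>V\<^esub>)) \<and>
     n \<ge> 1 \<and>
     algebraic_closure_of_fractions L \<phi> (power_series_ring V {1..n - 1}) \<longrightarrow>
     (let R = (\<lambda>i. \<phi> ` carrier (power_series_ring V {1..i}));
          V\<^sub>0 = \<phi> ` ring.indexed_const V ` carrier V;
          B = integral_closure L (R (n - 1));
          B\<^sub>i = (\<lambda>i. integral_closure B (R i))
      in \<forall>i. i < n - 1 \<longrightarrow>
           kaehler_direct_summand (B\<^sub>i i) V\<^sub>0 B V\<^sub>0 \<and>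
           kaehler_direct_summand (B\<^sub>i i) (R i) B (R (n - 1))))
    \<and>
    (field k \<and> has_characteristic k 0 \<and>
     algebraic_closure_of_fractions L' \<psi> (power_series_ring k {1..n'}) \<longrightarrow>
     (let R = (\<lambda>i. \<psi> ` carrier (power_series_ring k {1..i}));
          k\<^sub>0 = \<psi> ` ring.indexed_const k ` carrier k;
          B = integral_closure L' (R n');
          B\<^sub>i = (\<lambda>i. integral_closure B (R i))
      in \<forall>i. i < n' \<longrightarrow>
           kaehler_direct_summand (B\<^sub>i i) k\<^sub>0 B k\<^sub>0 \<and>
           kaehler_direct_summand (B\<^sub>i i) (R i) B (R n')))"
proof -
  have V: "cring V" if "discrete_valuation_ring V"
    using that discrete_valuation_ring.axioms(1) principal_domain.axioms(1) domain.axioms(1) by blast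
  have k: "cring k" if "field k"
    using that field.axioms(1) domain.axioms(1) by blast
  show ?thesis
    unfolding Let_def
  proof (intro conjI impI allI; elim conjE)
    fix i
    assume "discrete_valuation_ring V" "i < n - 1"
      and c: "algebraic_closure_of_fractions L \<phi> (power_series_ring V {1..n - 1})"
    then have "cring V" "{1..i} \<subseteq> {1..n - 1}" using V by auto
    note summand = kaehler_direct_summand_power_series[OF this c]
    show "kaehler_direct_summand
        (integral_closure (integral_closure L (\<phi> ` carrier (power_series_ring V {1..n - 1})))
          (\<phi> ` carrier (power_series_ring V {1..i})))
        (\<phi> ` ring.indexed_const V ` carrier V)
        (integral_closure L (\<phi> ` carrier (power_series_ring V {1..n - 1})))
        (\<phi> ` ring.indexed_const V ` carrier V)" by (rule summand(1))
    show "kaehler_direct_summand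
        (integral_closure (integral_closure L (\<phi> ` carrier (power_series_ring V {1..n - 1})))
          (\<phi> ` carrier (power_series_ring V {1..i})))
        (\<phi> ` carrier (power_series_ring V {1..i}))
        (integral_closure L (\<phi> ` carrier (power_series_ring V {1..n - 1})))
        (\<phi> ` carrier (power_series_ring V {1..n - 1}))" by (rule summand(2))
  next
    fix i
    assume "field k" "i < n'"
      and c: "algebraic_closure_of_fractions L' \<psi> (power_series_ring k {1..n'})"
    then have "cring k" "{1..i} \<subseteq> {1..n'}" using k by auto
    note summand = kaehler_direct_summand_power_series[OF this c]
    show "kaehler_direct_summand
        (integral_closure (integral_closure L' (\<psi> ` carrier (power_series_ring k {1..n'})))
          (\<psi> ` carrier (power_series_ring k {1..i})))
        (\<psi> ` ring.indexed_const k ` carrier k)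
        (integral_closure L' (\<psi> ` carrier (power_series_ring k {1..n'})))
        (\<psi> ` ring.indexed_const k ` carrier k)" by (rule summand(1))
    show "kaehler_direct_summand
        (integral_closure (integral_closure L' (\<psi> ` carrier (power_series_ring k {1..n'})))
          (\<psi> ` carrier (power_series_ring k {1..i})))
        (\<psi> ` carrier (power_series_ring k {1..i}))
        (integral_closure L' (\<psi> ` carrier (power_series_ring k {1..n'})))
        (\<psi> ` carrier (power_series_ring k {1..n'}))" by (rule summand(2))
  qed
qed

end
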